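(* There is a unique homomorphism $\chi:\mathbf{SB}(S_n)\to\mathbf{Br}_n(\mathbb{Z},\delta)$ (to the multiplicative monoid of the algebra) such that $$\chi(\sigma_{s_i})=s_i\quad\text{and}\quad\chi(\tau_{s_i})=\mathtt{s}_i,\qquad\text{for } i=1,2,\dots,n-1.$$
   Context: The singular Artin monoid $\mathbf{SB}(S_n)$ of type $A_{n-1}$ (the singular braid monoid on $n$ strands) is the monoid generated by invertible elements $\sigma_i=\sigma_{s_i}$ and elements $\tau_i=\tau_{s_i}$, $1\le i\le n-1$, subject to: $\sigma_i\sigma_j\sigma_i=\sigma_j\sigma_i\sigma_j$ and $\tau_i\sigma_j\sigma_i=\sigma_j\sigma_i\tau_j$ for $|i-j|=1$; $\sigma_i\sigma_j=\sigma_j\sigma_i$, $\tau_i\sigma_j=\sigma_j\tau_i$ and $\tau_i\tau_j=\tau_j\tau_i$ for $|i-j|>1$; and $\tau_i\sigma_i=\sigma_i\tau_i$ for all $i$. The classical Brauer algebra $\mathbf{Br}_n(\mathbb{Z},\delta)$, with $\delta$ an indeterminate, is the $\mathbb{Z}[\delta]$-algebra with basis all Brauer diagrams, i.e. partitions of $\underline n\cup\underline n'$ (with $\underline n=\{1,\dots,n\}$, $\underline n'=\{1',\dots,n'\}$) into two-element subsets. The product of two diagrams is obtained by identifying the primed vertices of the first with the corresponding unprimed vertices of the second, taking the induced partition of the remaining vertices into two-element subsets, and multiplying by $\delta^k$, where $k$ is the number of connected components supported only on the identified vertices. $s_i$ is the diagram of the transposition $(i,i+1)$, with parts $\{i,(i+1)'\}$,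 $\{i+1,i'\}$ and $\{j,j'\}$ for $j\ne i,i+1$. $\mathtt{s}_i$ is the diagram with parts $\{i,i+1\}$, $\{i',(i+1)'\}$ and $\{j,j'\}$ for $j\neq i,i+1$. *)

theory Defs
  imports
    "HOL-Computational_Algebra.Polynomial"
    "HOL-Library.Disjoint_Sets"
    "HOL-Library.FuncSet"
    "HOL-Algebra.Module"
begin

section \<open>Monoids given by generators and relations\<close>

inductive_set word_cong :: "'a set \<Rightarrow> ('a list \<times> 'a list) set \<Rightarrow> ('a list \<times> 'a list) set"
  for A :: "'a set" and R :: "('a list \<times> 'a list) set" where
  refl: "w \<in> lists A \<Longrightarrow> (w, w) \<in> word_cong A R"
| rel: "(u, v) \<in> R \<Longrightarrow> a \<in> lists A \<Longrightarrow> b \<in> lists A \<Longrightarrow> (a @ u @ b, a @ v @ b) \<in> word_cong A R"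
| sym: "(u, v) \<in> word_cong A R \<Longrightarrow> (v, u) \<in> word_cong A R"
| trans: "(u, v) \<in> word_cong A R \<Longrightarrow> (v, w) \<in> word_cong A R \<Longrightarrow> (u, w) \<in> word_cong A R"

text \<open>The relations \<open>R\<close> are meant to be pairs of words over the generators \<open>A\<close>.\<close>

definition presented_monoid :: "'a set \<Rightarrow> ('a list \<times> 'a list) set \<Rightarrow> 'a list set monoid" where
  "presented_monoid A R =
    \<lparr>carrier = lists A // word_cong A R,
     mult = (\<lambda>X Y. \<Union>x\<in>X. \<Union>y\<in>Y. word_cong A R `` {x @ y}),
     one = word_cong A R `` {[]}\<rparr>"

section \<open>The singular braid monoid\<close>

datatype sb_gen = Sigma nat | Sigma_inv nat | Tau nat

definition sb_gens :: "nat \<Rightarrow> sb_gen set" where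
  "sb_gens n = Sigma ` {1..<n} \<union> Sigma_inv ` {1..<n} \<union> Tau ` {1..<n}"

inductive_set sb_rels :: "nat \<Rightarrow> (sb_gen list \<times> sb_gen list) set"
  for n :: nat where
  inv_right: "i \<in> {1..<n} \<Longrightarrow> ([Sigma i, Sigma_inv i], []) \<in> sb_rels n"
| inv_left: "i \<in> {1..<n} \<Longrightarrow> ([Sigma_inv i, Sigma i], []) \<in> sb_rels n"
| braid: "i \<in> {1..<n} \<Longrightarrow> j \<in> {1..<n} \<Longrightarrow> \<bar>int i - int j\<bar> = 1 \<Longrightarrow>
    ([Sigma i, Sigma j, Sigma i], [Sigma j, Sigma i, Sigma j]) \<in> sb_rels n"
| mixed_braid: "i \<in> {1..<n} \<Longrightarrow> j \<in> {1..<n} \<Longrightarrow> \<bar>int i - int j\<bar> = 1 \<Longrightarrow>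
    ([Tau i, Sigma j, Sigma i], [Sigma j, Sigma i, Tau j]) \<in> sb_rels n"
| far_sigma_sigma: "i \<in> {1..<n} \<Longrightarrow> j \<in> {1..<n} \<Longrightarrow> \<bar>int i - int j\<bar> > 1 \<Longrightarrow>
    ([Sigma i, Sigma j], [Sigma j, Sigma i]) \<in> sb_rels n"
| far_tau_sigma: "i \<in> {1..<n} \<Longrightarrow> j \<in> {1..<n} \<Longrightarrow> \<bar>int i - int j\<bar> > 1 \<Longrightarrow>
    ([Tau i, Sigma j], [Sigma j, Tau i]) \<in> sb_rels n"
| far_tau_tau: "i \<in> {1..<n} \<Longrightarrow> j \<in> {1..<n} \<Longrightarrow> \<bar>int i - int j\<bar> > 1 \<Longrightarrow>
    ([Tau i, Tau j], [Tau j, Tau i]) \<in> sb_rels n"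
| tau_sigma: "i \<in> {1..<n} \<Longrightarrow> ([Tau i, Sigma i], [Sigma i, Tau i]) \<in> sb_rels n"

definition SB :: "nat \<Rightarrow> sb_gen list set monoid" where
  "SB n = presented_monoid (sb_gens n) (sb_rels n)"

definition sb_sigma :: "nat \<Rightarrow> nat \<Rightarrow> sb_gen list set" where
  "sb_sigma n i = word_cong (sb_gens n) (sb_rels n) `` {[Sigma i]}"

definition sb_tau :: "nat \<Rightarrow> nat \<Rightarrow> sb_gen list set" where
  "sb_tau n i = word_cong (sb_gens n) (sb_rels n) `` {[Tau i]}"

section \<open>The Brauer algebra\<close>

text \<open>\<open>Up i\<close> is the unprimed vertex \<open>i\<close>, \<open>Dn i\<close> the primed vertex \<open>i'\<close>.\<close>

datatype vertex = Up nat | Dn nat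

type_synonym diagram = "vertex set set"

definition brauer_diagrams :: "nat \<Rightarrow> diagram set" where
  "brauer_diagrams n =
    {d. partition_on (Up ` {1..n} \<union> Dn ` {1..n}) d \<and> (\<forall>b\<in>d. card b = 2)}"

definition id_diagram :: "nat \<Rightarrow> diagram" where
  "id_diagram n = {{Up j, Dn j} |j. j \<in> {1..n}}"

definition s_diagram :: "nat \<Rightarrow> nat \<Rightarrow> diagram" where
  "s_diagram n i =
    {{Up i, Dn (i + 1)}, {Up (i + 1), Dn i}} \<union> {{Up j, Dn j} |j. j \<in> {1..n} - {i, i + 1}}"

definition e_diagram :: "nat \<Rightarrow> nat \<Rightarrow> diagram" where
  "e_diagram n i =
    {{Up i, Up (i + 1)}, {Dn i, Dn (i + 1)}} \<union> {{Up j, Dn j} |j. j \<in> {1..n} - {i, i + 1}}"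

text \<open>
  Vertices of two diagrams placed one above the other: \<open>Mid i\<close> is the vertex obtained by
  identifying \<open>Dn i\<close> of the first with \<open>Up i\<close> of the second diagram, and \<open>Outer v\<close> is a
  remaining vertex.
\<close>

datatype glued_vertex = Outer vertex | Mid nat

fun glue_first :: "vertex \<Rightarrow> glued_vertex" where
  "glue_first (Up i) = Outer (Up i)"
| "glue_first (Dn i) = Mid i"

fun glue_second :: "vertex \<Rightarrow> glued_vertex" where
  "glue_second (Up i) = Mid i"
| "glue_second (Dn i) = Outer (Dn i)"

definition glued_blocks :: "diagram \<Rightarrow> diagram \<Rightarrow> glued_vertex set set" where
  "glued_blocks d1 d2 = (`) glue_first ` d1 \<union> (`) glue_second ` d2"

definition glued_components :: "diagram \<Rightarrow> diagram \<Rightarrow> glued_vertex set set" where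
  "glued_components d1 d2 =
    \<Union>(glued_blocks d1 d2) // {(x, y). \<exists>b\<in>glued_blocks d1 d2. x \<in> b \<and> y \<in> b}\<^sup>*"

definition diagram_comp :: "diagram \<Rightarrow> diagram \<Rightarrow> diagram" where
  "diagram_comp d1 d2 = (\<lambda>C. Outer -` C) ` glued_components d1 d2 - {{}}"

definition loops :: "diagram \<Rightarrow> diagram \<Rightarrow> nat" where
  "loops d1 d2 = card {C \<in> glued_components d1 d2. C \<subseteq> range Mid}"

text \<open>
  An element of the Brauer algebra is given by its coordinates in the basis of diagrams, the
  coefficient ring \<open>\<int>[\<delta>]\<close> being the type \<^typ>\<open>int poly\<close> with \<open>\<delta> = [:0, 1:]\<close>.
\<close>

definition basis_element :: "diagram \<Rightarrow> diagram \<Rightarrow> int poly" where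
  "basis_element d = (\<lambda>d'. if d' = d then 1 else 0)"

definition Br :: "nat \<Rightarrow> (int poly, diagram \<Rightarrow> int poly) module" where
  "Br n =
    \<lparr>carrier = {x. \<forall>d. d \<notin> brauer_diagrams n \<longrightarrow> x d = 0},
     mult = (\<lambda>x y d. \<Sum>(d1, d2) | d1 \<in> brauer_diagrams n \<and> d2 \<in> brauer_diagrams n \<and>
       diagram_comp d1 d2 = d. x d1 * y d2 * [:0, 1:] ^ loops d1 d2),
     one = basis_element (id_diagram n),
     zero = (\<lambda>d. 0),
     add = (\<lambda>x y d. x d + y d),
     smult = (\<lambda>p x d. p * x d)\<rparr>"

end

theory Submission
  imports Defs "HOL-Combinatorics.Permutations"
begin

text \<open>
  A presented monoid has the universal property that a map of generators into a monoid extends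
  (uniquely) to a homomorphism as soon as it respects the relations. Two things have to be shown:
  that \<open>Br n\<close> is a monoid under multiplication, and that its elements \<open>s\<^sub>i\<close> and \<open>e\<^sub>i\<close> (the images
  of \<open>\<sigma>\<^sub>i\<close> and \<open>\<tau>\<^sub>i\<close>) satisfy the relations of the singular braid monoid. For uniqueness,
  the value at \<open>\<sigma>\<^sub>i\<inverse>\<close> is forced because an element of a monoid has at most one inverse.

  For the monoid laws the essential point is associativity of gluing together with the count of
  closed loops. Both bracketings of a threefold product are read off from one three-layer graph:
  gluing two of the layers first merely replaces part of that graph by its components, with the
  vertices hidden in that step removed. Such a contraction does not change which visible
  vertices are connected, and the components that it loses are exactly those made of hidden
  vertices only (\<open>comps_contract\<close>, \<open>card_comps_contract\<close>). That a composite of Brauer diagrams has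
  blocks of size two follows from a count: a component of a graph has at most one vertex more
  than it has edges, while inner vertices have degree two and outer vertices degree one, so a
  component has at most two outer vertices, and an even number of them (\<open>card_component\<close>).

  For the relations, \<open>s\<^sub>i\<close> is the diagram of a transposition, and gluing with a permutation
  diagram only renames vertices and never creates loops. All relations between the \<open>s\<^sub>i\<close> thus
  become identities between permutations, and all relations between an \<open>e\<^sub>i\<close> and the \<open>s\<^sub>j\<close> are
  instances of \<open>\<pi> e(a, b) = e(\<pi> a, \<pi> b) \<pi>\<close> (\<open>perm_cupcap\<close>), where \<open>e(a, b)\<close> joins \<open>a\<close> to \<open>b\<close> above and below.
  Only \<open>e\<^sub>i e\<^sub>j = e\<^sub>j e\<^sub>i\<close> for distant \<open>i\<close>, \<open>j\<close> is computed by hand (\<open>cupcap_mult\<close>).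
\<close>

section \<open>Connected components of a family of blocks\<close>

definition conn :: "'a set set \<Rightarrow> ('a \<times> 'a) set" where
  "conn B = {(x, y). \<exists>b\<in>B. x \<in> b \<and> y \<in> b}\<^sup>*"

definition comps :: "'a set set \<Rightarrow> 'a set set" where
  "comps B = \<Union>B // conn B"

lemma conn_refl [simp]: "(x, x) \<in> conn B"
  by (simp add: conn_def)

lemma conn_block: "b \<in> B \<Longrightarrow> x \<in> b \<Longrightarrow> y \<in> b \<Longrightarrow> (x, y) \<in> conn B"
  unfolding conn_def by (rule r_into_rtrancl) blast

lemma conn_sym: "(x, y) \<in> conn B \<Longrightarrow> (y, x) \<in> conn B"
proof -
  have "sym (conn B)"
    unfolding conn_def by (rule sym_rtrancl) (auto simp: sym_def)
  then show "(x, y) \<in> conn B \<Longrightarrow> (y, x) \<in> conn B" by (rule symD)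
qed

lemma conn_trans: "(x, y) \<in> conn B \<Longrightarrow> (y, z) \<in> conn B \<Longrightarrow> (x, z) \<in> conn B"
  unfolding conn_def by (rule rtrancl_trans)

lemma conn_mono: "A \<subseteq> B \<Longrightarrow> (x, y) \<in> conn A \<Longrightarrow> (x, y) \<in> conn B"
proof -
  assume "A \<subseteq> B"
  then have "conn A \<subseteq> conn B"
    unfolding conn_def by (intro rtrancl_mono) blast
  then show "(x, y) \<in> conn A \<Longrightarrow> (x, y) \<in> conn B" by blast
qed

lemma conn_induct [consumes 1, case_names start step]:
  assumes "(x, y) \<in> conn B" and "P x"
    and "\<And>y z b. (x, y) \<in> conn B \<Longrightarrow> b \<in> B \<Longrightarrow> y \<in> b \<Longrightarrow> z \<in> b \<Longrightarrow> P y \<Longrightarrow> P z"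
  shows "P y"
  using assms(1) unfolding conn_def
proof (induction rule: rtrancl_induct)
  case base
  show ?case by (rule assms(2))
next
  case (step y z)
  then show ?case using assms(3)[of y _ z] unfolding conn_def by blast
qed

lemma conn_map:
  assumes "(x, y) \<in> conn A" and "\<And>b. b \<in> A \<Longrightarrow> \<exists>c\<in>B. f ` b \<subseteq> c"
  shows "(f x, f y) \<in> conn B"
  using assms(1)
proof (induction rule: conn_induct)
  case (step y z b)
  obtain c where "c \<in> B" "f ` b \<subseteq> c" using assms(2) step by blast
  then show ?case using step conn_block[of c B "f y" "f z"] by (blast intro: conn_trans)
qed simp

lemma conn_stays:
  assumes "(x, y) \<in> conn B" "x \<in> C" "\<And>b. b \<in> B \<Longrightarrow> b \<inter> C \<noteq> {} \<Longrightarrow> b \<subseteq> C"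
  shows "y \<in> C"
  using assms(1) by (induction rule: conn_induct) (use assms in blast)+

text \<open>
  A component is a non-empty connected set that no block crosses. This intrinsic description
  replaces the quotient in all later arguments.
\<close>

lemma comps_iff:
  "C \<in> comps B \<longleftrightarrow> C \<noteq> {} \<and> C \<subseteq> \<Union>B \<and> (\<forall>b\<in>B. b \<inter> C \<noteq> {} \<longrightarrow> b \<subseteq> C) \<and>
    (\<forall>x\<in>C. \<forall>y\<in>C. (x, y) \<in> conn B)" (is "?L \<longleftrightarrow> ?R")
proof
  assume ?L
  then obtain x where x: "x \<in> \<Union>B" and C: "C = conn B `` {x}"
    unfolding comps_def by (blast elim: quotientE)
  have "y \<in> \<Union>B" if "(x, y) \<in> conn B" for y
    using that by (induction rule: conn_induct) (use x in auto)
  then have "C \<subseteq> \<Union>B" unfolding C by blast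
  moreover have "x \<in> C" unfolding C by simp
  moreover have "\<forall>b\<in>B. b \<inter> C \<noteq> {} \<longrightarrow> b \<subseteq> C"
  proof (intro ballI impI subsetI)
    fix b z assume "b \<in> B" "b \<inter> C \<noteq> {}" "z \<in> b"
    then obtain y where "y \<in> b" "(x, y) \<in> conn B" unfolding C by auto
    then show "z \<in> C"
      using conn_trans[OF _ conn_block] \<open>b \<in> B\<close> \<open>z \<in> b\<close> unfolding C by fastforce
  qed
  moreover have "\<forall>y\<in>C. \<forall>z\<in>C. (y, z) \<in> conn B"
    unfolding C using conn_trans[OF conn_sym] by fastforce
  ultimately show ?R by blast
next
  assume R: ?R
  then obtain x where x: "x \<in> C" by auto
  have closed: "\<And>b. b \<in> B \<Longrightarrow> b \<inter> C \<noteq> {} \<Longrightarrow> b \<subseteq> C" using R by simp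
  have "C = conn B `` {x}"
  proof
    show "C \<subseteq> conn B `` {x}" using R x by auto
    show "conn B `` {x} \<subseteq> C" using conn_stays[OF _ x closed] by auto
  qed
  moreover have "x \<in> \<Union>B" using R x by auto
  ultimately show ?L unfolding comps_def by (simp add: quotientI)
qed

lemma comps_nonempty: "C \<in> comps B \<Longrightarrow> C \<noteq> {}"
  and comps_subset: "C \<in> comps B \<Longrightarrow> C \<subseteq> \<Union>B"
  and comps_block: "C \<in> comps B \<Longrightarrow> b \<in> B \<Longrightarrow> b \<inter> C \<noteq> {} \<Longrightarrow> b \<subseteq> C"
  and comps_conn: "C \<in> comps B \<Longrightarrow> x \<in> C \<Longrightarrow> y \<in> C \<Longrightarrow> (x, y) \<in> conn B"
  by (simp_all add: comps_iff)

lemma comps_closed: "C \<in> comps B \<Longrightarrow> x \<in> C \<Longrightarrow> (x, y) \<in> conn B \<Longrightarrow> y \<in> C"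
  by (rule conn_stays[OF _ _ comps_block])

lemma comps_cover: "\<Union>(comps B) = \<Union>B"
proof
  show "\<Union>(comps B) \<subseteq> \<Union>B" using comps_subset by (rule Union_least)
  show "\<Union>B \<subseteq> \<Union>(comps B)"
  proof
    fix x assume "x \<in> \<Union>B"
    then have "conn B `` {x} \<in> comps B" unfolding comps_def by (rule quotientI)
    moreover have "x \<in> conn B `` {x}" by simp
    ultimately show "x \<in> \<Union>(comps B)" by (rule UnionI)
  qed
qed

lemma comps_obtain:
  assumes "x \<in> b" "b \<in> B"
  obtains C where "C \<in> comps B" "x \<in> C" "b \<subseteq> C"
proof -
  have "x \<in> \<Union>(comps B)" unfolding comps_cover using assms by auto
  then obtain C where "C \<in> comps B" "x \<in> C" by auto
  moreover from this have "b \<subseteq> C" using comps_block[of C B b] assms by auto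
  ultimately show ?thesis by (rule that)
qed

lemma comps_unique:
  assumes "C \<in> comps B" "D \<in> comps B" "x \<in> C" "x \<in> D"
  shows "C = D"
proof
  show "C \<subseteq> D" using comps_conn[OF assms(1,3)] comps_closed[OF assms(2,4)] by auto
  show "D \<subseteq> C" using comps_conn[OF assms(2,4)] comps_closed[OF assms(1,3)] by auto
qed

lemma partition_comps: "partition_on (\<Union>B) (comps B)"
proof (rule partition_onI)
  show "disjnt C D" if "C \<in> comps B" "D \<in> comps B" "C \<noteq> D" for C D
    using comps_unique[OF that(1,2)] that(3) by (auto simp: disjnt_def)
  show "{} \<notin> comps B" using comps_nonempty by auto
qed (rule comps_cover)

lemma conn_comps: "(x, y) \<in> conn B \<Longrightarrow> x = y \<or> (\<exists>C\<in>comps B. x \<in> C \<and> y \<in> C)"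
proof (induction rule: conn_induct)
  case (step y z b)
  obtain C where C: "C \<in> comps B" "y \<in> C" "b \<subseteq> C" using comps_obtain[OF step(3,2)] .
  then have "x \<in> C" using comps_closed[OF C(1,2) conn_sym[OF step(1)]] by simp
  then show ?case using C step by auto
qed simp

text \<open>
  The tool for computing components: guess the partition, check that every block lies in a part
  and that every part is connected. Empty blocks are harmless, since they contribute no vertex.
\<close>

lemma comps_eqI:
  assumes part: "partition_on V P" and "\<Union>B = V"
    and refine: "\<And>b. b \<in> B \<Longrightarrow> b \<noteq> {} \<Longrightarrow> \<exists>p\<in>P. b \<subseteq> p"
    and conn: "\<And>p x y. p \<in> P \<Longrightarrow> x \<in> p \<Longrightarrow> y \<in> p \<Longrightarrow> (x, y) \<in> conn B"
  shows "comps B = P"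
proof -
  have dj: "p = q" if "p \<in> P" "q \<in> P" "x \<in> p" "x \<in> q" for p q x
    using partition_onD2[OF part] that by (auto simp: disjoint_def)
  have sub: "p \<in> comps B" if p: "p \<in> P" for p
    unfolding comps_iff
  proof (intro conjI ballI impI)
    show "p \<noteq> {}" using partition_onD3[OF part] p by auto
    show "p \<subseteq> \<Union>B" using partition_onD1[OF part] assms(2) p by auto
    fix b assume b: "b \<in> B" "b \<inter> p \<noteq> {}"
    then obtain q where q: "q \<in> P" "b \<subseteq> q" using refine[of b] by auto
    obtain x where "x \<in> b" "x \<in> p" using b by auto
    then have "q = p" using dj[OF q(1) p, of x] q by auto
    then show "b \<subseteq> p" using q by simp
  qed (use conn p in simp)
  have "C \<in> P" if C: "C \<in> comps B" for C
  proof -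
    obtain x where x: "x \<in> C" using comps_nonempty[OF C] by blast
    then have "x \<in> V" using comps_subset[OF C] assms(2) by auto
    then obtain p where p: "p \<in> P" "x \<in> p" using partition_onD1[OF part] by auto
    then have "C = p" using comps_unique[OF C sub x(1)] by simp
    then show ?thesis using p by simp
  qed
  then show ?thesis using sub by auto
qed

lemma comps_image:
  assumes "inj f"
  shows "comps ((`) f ` B) = (`) f ` comps B"
proof (rule comps_eqI)
  show "partition_on (f ` \<Union>B) ((`) f ` comps B)"
  proof -
    have "(`) f ` comps B - {{}} = (`) f ` comps B" using comps_nonempty[of _ B] by auto
    then show ?thesis
      using partition_on_inj_image[OF partition_comps inj_on_subset[OF assms subset_UNIV], of B] by simp
  qed
  show "\<Union>((`) f ` B) = f ` \<Union>B" by blast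
  show "\<exists>p\<in>(`) f ` comps B. b \<subseteq> p" if b: "b \<in> (`) f ` B" "b \<noteq> {}" for b
  proof -
    obtain b' x where b': "b' \<in> B" "b = f ` b'" "x \<in> b'" using b by auto
    obtain C where "C \<in> comps B" "b' \<subseteq> C" using comps_obtain[OF b'(3,1)] .
    then show ?thesis using b' by auto
  qed
  show "(x, y) \<in> conn ((`) f ` B)" if p: "p \<in> (`) f ` comps B" "x \<in> p" "y \<in> p" for p x y
  proof -
    obtain C u v where "C \<in> comps B" "u \<in> C" "v \<in> C" "x = f u" "y = f v"
      using p by auto
    moreover from this have "(f u, f v) \<in> conn ((`) f ` B)"
      by (intro conn_map[OF comps_conn]) auto
    ultimately show ?thesis by simp
  qed
qed

section \<open>Contraction of hidden vertices\<close>

text \<open>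
  The components of \<open>A\<close> seen as blocks on the visible vertices, those outside \<open>M\<close>. A component
  without visible vertices disappears. Composing two diagrams is such a contraction, with the
  glued vertices hidden.
\<close>

definition contract :: "'a set \<Rightarrow> 'a set set \<Rightarrow> 'a set set" where
  "contract M A = (\<lambda>C. C - M) ` comps A - {{}}"

lemma contractI: "C \<in> comps A \<Longrightarrow> x \<in> C \<Longrightarrow> x \<notin> M \<Longrightarrow> C - M \<in> contract M A"
  unfolding contract_def by auto

lemma contractE:
  assumes "p \<in> contract M A"
  obtains C where "C \<in> comps A" "p = C - M"
  using assms unfolding contract_def by auto

text \<open>
  A set of hidden vertices is met by no block of \<open>B\<close>, so adding \<open>B\<close> neither enlarges it nor
  creates new connections inside it.
\<close>

lemma comps_inside_hidden:
  assumes "\<Union>B \<inter> M = {}" and "C \<subseteq> M"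
  shows "C \<in> comps (A \<union> B) \<longleftrightarrow> C \<in> comps A"
proof
  assume C: "C \<in> comps (A \<union> B)"
  have "(x, y) \<in> conn A" if x: "x \<in> C" and xy: "(x, y) \<in> conn (A \<union> B)" for x y
    using xy
  proof (induction rule: conn_induct)
    case (step y z b)
    have "y \<in> C" by (rule comps_closed[OF C x step(1)])
    then have "b \<in> A" using step(2,3) assms by auto
    then show ?case by (rule conn_trans[OF step(5) conn_block[OF _ step(3,4)]])
  qed simp
  then have "\<forall>x\<in>C. \<forall>y\<in>C. (x, y) \<in> conn A" using comps_conn[OF C] by simp
  moreover have "C \<subseteq> \<Union>A" using comps_subset[OF C] assms by auto
  ultimately show "C \<in> comps A"
    unfolding comps_iff using comps_nonempty[OF C] comps_block[OF C] by simp
next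
  assume C: "C \<in> comps A"
  have "b \<subseteq> C" if "b \<in> A \<union> B" "b \<inter> C \<noteq> {}" for b
    using that assms comps_block[OF C, of b] by auto
  moreover have "\<forall>x\<in>C. \<forall>y\<in>C. (x, y) \<in> conn (A \<union> B)"
    by (intro ballI conn_mono[OF _ comps_conn[OF C]]) auto
  moreover have "C \<subseteq> \<Union>(A \<union> B)" using comps_subset[OF C] by auto
  ultimately show "C \<in> comps (A \<union> B)"
    unfolding comps_iff using comps_nonempty[OF C] by simp
qed

text \<open>
  Contracting the hidden vertices before adding further blocks gives the same visible
  components as doing it afterwards: a path in \<open>A \<union> B\<close> between visible vertices splits into steps
  in \<open>B\<close>, whose end points are visible, and stretches inside a single component of \<open>A\<close>, and
  each stretch is one block of the contraction.
\<close>

lemma comps_contract: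
  assumes hidden: "\<Union>B \<inter> M = {}"
  shows "comps (contract M A \<union> B) = contract M (A \<union> B)"
proof (rule comps_eqI)
  let ?P = "contract M (A \<union> B)"
  let ?A = "contract M A"
  show "partition_on (\<Union>(A \<union> B) - M) ?P"
  proof (rule partition_onI)
    show "\<Union>?P = \<Union>(A \<union> B) - M"
      unfolding contract_def comps_cover[symmetric, of "A \<union> B"] by blast
    show "disjnt p q" if "p \<in> ?P" "q \<in> ?P" "p \<noteq> q" for p q
      using that comps_unique[of _ "A \<union> B"] unfolding contract_def disjnt_def by blast
  qed (simp add: contract_def)
  show "\<Union>(?A \<union> B) = \<Union>(A \<union> B) - M"
  proof -
    have "\<Union>?A = \<Union>A - M" unfolding contract_def comps_cover[symmetric, of A] by blast
    then show ?thesis using hidden by blast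
  qed
  show "\<exists>p\<in>?P. b \<subseteq> p" if b: "b \<in> ?A \<union> B" "b \<noteq> {}" for b
    using b(1)
  proof
    assume "b \<in> ?A"
    then obtain C x where C: "C \<in> comps A" "b = C - M" "x \<in> C" "x \<notin> M"
      unfolding contract_def by blast
    then obtain a where a: "a \<in> A" "x \<in> a" using comps_subset[of C A] by auto
    obtain D where D: "D \<in> comps (A \<union> B)" "x \<in> D" using comps_obtain[of x a "A \<union> B"] a by auto
    have "C \<subseteq> D"
    proof
      fix y assume "y \<in> C"
      then have "(x, y) \<in> conn (A \<union> B)"
        using comps_conn[OF C(1,3)] by (auto intro: conn_mono[of A])
      then show "y \<in> D" by (rule comps_closed[OF D])
    qed
    then have "b \<subseteq> D - M" using C(2) by auto
    then show ?thesis using contractI[OF D C(4)] by auto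
  next
    assume "b \<in> B"
    obtain x where "x \<in> b" using b by auto
    then obtain D where D: "D \<in> comps (A \<union> B)" "b \<subseteq> D"
      using comps_obtain[of x b "A \<union> B"] \<open>b \<in> B\<close> by auto
    then have "b \<subseteq> D - M" using \<open>b \<in> B\<close> hidden by auto
    then show ?thesis using contractI[OF D(1), of x] \<open>x \<in> b\<close> by auto
  qed
  have A': "(x, y) \<in> conn ?A" if "(x, y) \<in> conn A" "x \<notin> M" "y \<notin> M" for x y
    using conn_comps[OF that(1)]
  proof
    assume "\<exists>C\<in>comps A. x \<in> C \<and> y \<in> C"
    then obtain C where "C \<in> comps A" "x \<in> C" "y \<in> C" by blast
    then show ?thesis using contractI[of C A x M] that by (intro conn_block[of "C - M"]) auto
  qed simp
  have A'B: "(x, y) \<in> conn (?A \<union> B)" if xy: "(x, y) \<in> conn (A \<union> B)" "x \<notin> M" "y \<notin> M" for x y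
  proof -
    \<comment> \<open>Invariant along the path: \<open>z\<close> is the visible vertex where the current stretch inside \<open>A\<close>
        began; the path up to \<open>z\<close> has already been contracted.\<close>
    have "\<exists>z. (x, z) \<in> conn (?A \<union> B) \<and> z \<notin> M \<and> (z, y) \<in> conn A"
      using xy(1)
    proof (induction rule: conn_induct)
      case start
      show ?case using xy(2) by (intro exI[of _ x]) simp
    next
      case (step y y' b)
      then obtain z where z: "(x, z) \<in> conn (?A \<union> B)" "z \<notin> M" "(z, y) \<in> conn A" by auto
      show ?case
      proof (cases "b \<in> A")
        case True
        have "(z, y') \<in> conn A" by (rule conn_trans[OF z(3) conn_block[OF True step(3,4)]])
        then show ?thesis using z by auto
      next
        case False
        then have b: "b \<in> B" using step(2) by simp
        then have y: "y \<notin> M" "y' \<notin> M" using step(3,4) hidden by auto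
        have "(z, y) \<in> conn (?A \<union> B)"
          by (rule conn_mono[OF _ A'[OF z(3,2) y(1)]]) simp
        moreover have "(y, y') \<in> conn (?A \<union> B)"
          by (rule conn_block[of b]) (use b step(3,4) in auto)
        ultimately have "(x, y') \<in> conn (?A \<union> B)" using z(1) conn_trans by metis
        then show ?thesis using y(2) by (intro exI[of _ y']) simp
      qed
    qed
    then obtain z where z: "(x, z) \<in> conn (?A \<union> B)" "z \<notin> M" "(z, y) \<in> conn A" by auto
    have "(z, y) \<in> conn (?A \<union> B)" by (rule conn_mono[OF _ A'[OF z(3,2) xy(3)]]) simp
    then show ?thesis by (rule conn_trans[OF z(1)])
  qed
  show "(x, y) \<in> conn (?A \<union> B)" if p: "p \<in> ?P" "x \<in> p" "y \<in> p" for p x y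
  proof -
    obtain C where C: "C \<in> comps (A \<union> B)" "p = C - M" using contractE[OF p(1)] .
    show ?thesis by (rule A'B) (use C p in \<open>auto intro: comps_conn\<close>)
  qed
qed

text \<open>
  The components contained in the hidden set \<open>M \<union> N\<close> are counted in two stages: those inside \<open>M\<close>
  are already components of \<open>A\<close>, and the others survive the contraction of \<open>M\<close> and then lie
  inside \<open>N\<close>.
\<close>

lemma card_comps_contract:
  assumes hidden: "\<Union>B \<inter> M = {}" and fin: "finite (comps (A \<union> B))"
  shows "card {C \<in> comps (A \<union> B). C \<subseteq> M \<union> N} =
    card {C \<in> comps A. C \<subseteq> M} + card {C \<in> comps (contract M A \<union> B). C \<subseteq> N}"
proof -
  let ?I = "{C \<in> comps (A \<union> B). C \<subseteq> M}"
  let ?J = "{C \<in> comps (A \<union> B). C \<subseteq> M \<union> N \<and> \<not> C \<subseteq> M}"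
  have "{C \<in> comps (A \<union> B). C \<subseteq> M \<union> N} = ?I \<union> ?J" by blast
  then have "card {C \<in> comps (A \<union> B). C \<subseteq> M \<union> N} = card ?I + card ?J"
    using fin by (simp add: card_Un_disjoint disjoint_iff)
  moreover have "?I = {C \<in> comps A. C \<subseteq> M}"
    by (rule Collect_cong) (use comps_inside_hidden[OF hidden, of _ A] in auto)
  moreover have "card ?J = card {C \<in> comps (contract M A \<union> B). C \<subseteq> N}"
  proof -
    have "inj_on (\<lambda>C. C - M) ?J"
      by (rule inj_onI) (use comps_unique[of _ "A \<union> B"] in blast)
    moreover have "(\<lambda>C. C - M) ` ?J = {C \<in> comps (contract M A \<union> B). C \<subseteq> N}"
      unfolding comps_contract[OF hidden] by (auto simp: contract_def)
    ultimately show ?thesis by (metis (no_types, lifting) card_image)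
  qed
  ultimately show ?thesis by simp
qed

section \<open>Edges of a component\<close>

text \<open>
  A connected graph has at most one vertex more than it has edges: a subset of \<open>C\<close> that satisfies
  the bound and is not yet all of \<open>C\<close> is left by some edge, and adding the far end point of that
  edge preserves the bound. So a largest such subset is \<open>C\<close>.
\<close>

lemma comps_edge_count:
  assumes C: "C \<in> comps E" and fin: "finite E" "finite C" and edges: "\<And>b. b \<in> E \<Longrightarrow> card b = 2"
  shows "card C \<le> card {b \<in> E. b \<subseteq> C} + 1"
proof -
  define G where "G S \<longleftrightarrow> S \<noteq> {} \<and> S \<subseteq> C \<and> card S \<le> card {b \<in> E. b \<subseteq> S} + 1" for S
  obtain x where x: "x \<in> C" using comps_nonempty[OF C] by auto
  have "G {x}" using x by (simp add: G_def)
  moreover have "\<forall>S. G S \<longrightarrow> card S < card C + 1"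
    using fin by (simp add: G_def card_mono le_imp_less_Suc)
  ultimately have "\<exists>S. G S \<and> (\<forall>T. G T \<longrightarrow> card T \<le> card S)"
    by (rule ex_has_greatest_nat)
  then obtain S where "G S" and max: "\<And>T. G T \<Longrightarrow> card T \<le> card S" by blast
  then have S: "S \<noteq> {}" "S \<subseteq> C" "card S \<le> card {b \<in> E. b \<subseteq> S} + 1" by (simp_all add: G_def)
  have "S = C"
  proof (rule ccontr)
    assume "S \<noteq> C"
    then obtain y where y: "y \<in> C" "y \<notin> S" using S by blast
    obtain z where z: "z \<in> S" using S by blast
    have "(z, y) \<in> conn E" using C y z S by (auto intro: comps_conn)
    then obtain b where b: "b \<in> E" "b \<inter> S \<noteq> {}" "\<not> b \<subseteq> S"
      using conn_stays[OF _ z] y(2) by metis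
    obtain u v where uv: "u \<in> b" "u \<in> S" "v \<in> b" "v \<notin> S" using b by blast
    then have "b = {u, v}" using edges[OF b(1)] by (auto simp: card_2_iff)
    have "b \<subseteq> C" using comps_block[OF C b(1)] b S by auto
    let ?T = "insert v S"
    have finS: "finite S" using S fin finite_subset by blast
    have "card (insert b {b \<in> E. b \<subseteq> S}) \<le> card {b \<in> E. b \<subseteq> ?T}"
      using fin b uv \<open>b = {u, v}\<close> by (intro card_mono) auto
    then have "Suc (card {b \<in> E. b \<subseteq> S}) \<le> card {b \<in> E. b \<subseteq> ?T}"
      using fin b by simp
    then have "G ?T" using S uv finS \<open>b \<subseteq> C\<close> by (auto simp: G_def)
    then have "card ?T \<le> card S" by (rule max)
    then show False using uv finS by simp
  qed
  then show ?thesis using S by simp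
qed


section \<open>Associativity of gluing\<close>

lemma glued_components_comps: "glued_components d1 d2 = comps (glued_blocks d1 d2)"
  by (simp add: glued_components_def comps_def conn_def)

lemma diagram_comp_comps:
  "diagram_comp d1 d2 = (-`) Outer ` comps (glued_blocks d1 d2) - {{}}"
  by (simp add: diagram_comp_def glued_components_comps)

lemma loops_comps: "loops d1 d2 = card {C \<in> comps (glued_blocks d1 d2). C \<subseteq> range Mid}"
  by (simp add: loops_def glued_components_comps)

lemma image_minus_empty:
  assumes "f {} = {}"
  shows "f ` (X - {{}}) - {{}} = f ` X - {{}}"
  using assms by auto

text \<open>
  One bracketing of a threefold product, in a form that covers both. The graph \<open>S\<close> of all three
  layers consists of a copy, under \<open>g\<close>, of the gluing of \<open>p\<close> and \<open>q\<close>, and of the remaining layer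
  \<open>B\<close>; \<open>u\<close> and \<open>v\<close> are the composite of \<open>p\<close> and \<open>q\<close> and the remaining diagram, in either order, and \<open>k\<close>
  embeds their gluing. Contracting the middle vertices of the first gluing turns \<open>S\<close> into the
  second gluing, so the final composite and the total number of loops depend only on \<open>S\<close> and on
  which of its vertices are hidden.
\<close>

lemma two_stage_gluing:
  fixes g k :: "glued_vertex \<Rightarrow> 'a" and out :: "vertex \<Rightarrow> 'a"
  assumes g: "inj g" and k: "inj k" and k_out: "\<And>v. k (Outer v) = out v"
    and fresh: "\<And>i v. g (Mid i) \<noteq> out v"
    and hidden: "\<Union>B \<inter> g ` range Mid = {}"
    and second: "(`) (g \<circ> Outer) ` diagram_comp p q \<union> B = (`) k ` glued_blocks u v"
    and all: "S = (`) g ` glued_blocks p q \<union> B" and fin: "finite (comps S)"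
  shows "diagram_comp u v = (-`) out ` comps S - {{}}"
    and "loops p q + loops u v = card {C \<in> comps S. C \<subseteq> g ` range Mid \<union> k ` range Mid}"
proof -
  let ?A = "(`) g ` glued_blocks p q" and ?M = "g ` range Mid"
  have A: "comps ?A = (`) g ` comps (glued_blocks p q)"
    by (rule comps_image[OF g])
  \<comment> \<open>Removing the hidden vertices from a component of the first gluing leaves its outer
      vertices: a block of the composite of \<open>p\<close> and \<open>q\<close>, or nothing in the case of a loop.\<close>
  have minus: "g ` C - ?M = (g \<circ> Outer) ` (Outer -` C)" for C
  proof
    show "g ` C - ?M \<subseteq> (g \<circ> Outer) ` (Outer -` C)"
    proof
      fix x assume "x \<in> g ` C - ?M"
      then obtain y where "y \<in> C" "x = g y" "y \<notin> range Mid" by auto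
      then show "x \<in> (g \<circ> Outer) ` (Outer -` C)" by (cases y) auto
    qed
    show "(g \<circ> Outer) ` (Outer -` C) \<subseteq> g ` C - ?M"
      using injD[OF g] by auto
  qed
  have "contract ?M ?A = (\<lambda>C. g ` C - ?M) ` comps (glued_blocks p q) - {{}}"
    unfolding contract_def A by (simp only: image_image)
  also have "\<dots> = (\<lambda>C. (g \<circ> Outer) ` (Outer -` C)) ` comps (glued_blocks p q) - {{}}"
    by (simp only: minus)
  also have "\<dots> = (`) (g \<circ> Outer) ` ((-`) Outer ` comps (glued_blocks p q)) - {{}}"
    by (simp only: image_image)
  also have "\<dots> = (`) (g \<circ> Outer) ` diagram_comp p q"
    unfolding diagram_comp_comps by (subst image_minus_empty[symmetric]) auto
  finally have "contract ?M ?A \<union> B = (`) k ` glued_blocks u v"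
    using second by (simp only:)
  then have uv: "comps (contract ?M ?A \<union> B) = (`) k ` comps (glued_blocks u v)"
    by (simp add: comps_image[OF k])
  then have uv': "(`) k ` comps (glued_blocks u v) = contract ?M S"
    using comps_contract[OF hidden, of ?A] all by simp
  have out: "out -` (k ` C) = Outer -` C" for C
    using inj_image_mem_iff[OF k] by (simp add: vimage_def flip: k_out)
  have "(-`) Outer ` comps (glued_blocks u v) = (-`) out ` (`) k ` comps (glued_blocks u v)"
    by (simp add: image_image out)
  also have "\<dots> = (-`) out ` contract ?M S"
    by (simp only: uv')
  finally have "diagram_comp u v = (-`) out ` contract ?M S - {{}}"
    unfolding diagram_comp_comps by simp
  also have "\<dots> = (-`) out ` comps S - {{}}"
  proof -
    have "out v \<notin> ?M" for v using fresh[of _ v] by force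
    then have "out -` (C - ?M) = out -` C" for C by auto
    then have "(\<lambda>C. out -` (C - ?M)) ` comps S = (-`) out ` comps S" by (simp only:)
    then have "(-`) out ` (\<lambda>C. C - ?M) ` comps S = (-`) out ` comps S"
      by (simp only: image_image)
    then show ?thesis
      unfolding contract_def by (subst image_minus_empty) (simp, simp only:)
  qed
  finally show "diagram_comp u v = (-`) out ` comps S - {{}}" .
  have "card {C \<in> comps ?A. C \<subseteq> ?M} = loops p q"
  proof -
    have "{C \<in> comps ?A. C \<subseteq> ?M} = (`) g ` {C \<in> comps (glued_blocks p q). C \<subseteq> range Mid}"
      unfolding A using g by (auto simp: inj_image_subset_iff)
    then show ?thesis unfolding loops_comps
      using inj_image_eq_iff[OF g] by (simp add: card_image inj_on_def)
  qed
  moreover have "card {C \<in> comps (contract ?M ?A \<union> B). C \<subseteq> k ` range Mid} = loops u v"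
  proof -
    have "{C \<in> comps (contract ?M ?A \<union> B). C \<subseteq> k ` range Mid} =
      (`) k ` {C \<in> comps (glued_blocks u v). C \<subseteq> range Mid}"
      unfolding uv using k by (auto simp: inj_image_subset_iff)
    then show ?thesis unfolding loops_comps
      using inj_image_eq_iff[OF k] by (simp add: card_image inj_on_def)
  qed
  ultimately show "loops p q + loops u v = card {C \<in> comps S. C \<subseteq> ?M \<union> k ` range Mid}"
    using card_comps_contract[OF hidden, of ?A "k ` range Mid"] fin all by simp
qed

text \<open>
  Vertices of three diagrams placed above each other: \<open>Mid12\<close> and \<open>Mid23\<close> are the levels where
  the first and second, respectively the second and third, diagrams are identified. The maps
  \<open>embed12\<close> and \<open>embed23\<close> place the gluing of two adjacent diagrams in the stack; \<open>embed_lower\<close> and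
  \<open>embed_upper\<close> place the gluing of such a composite with the remaining third, respectively first,
  diagram, where one of the levels is no longer visible.
\<close>

datatype stack_vertex = Outer3 vertex | Mid12 nat | Mid23 nat

fun layer1 :: "vertex \<Rightarrow> stack_vertex" where
  "layer1 (Up i) = Outer3 (Up i)" | "layer1 (Dn i) = Mid12 i"

fun layer2 :: "vertex \<Rightarrow> stack_vertex" where
  "layer2 (Up i) = Mid12 i" | "layer2 (Dn i) = Mid23 i"

fun layer3 :: "vertex \<Rightarrow> stack_vertex" where
  "layer3 (Up i) = Mid23 i" | "layer3 (Dn i) = Outer3 (Dn i)"

fun embed12 :: "glued_vertex \<Rightarrow> stack_vertex" where
  "embed12 (Outer v) = (case v of Up i \<Rightarrow> Outer3 (Up i) | Dn i \<Rightarrow> Mid23 i)"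
| "embed12 (Mid i) = Mid12 i"

fun embed23 :: "glued_vertex \<Rightarrow> stack_vertex" where
  "embed23 (Outer v) = (case v of Up i \<Rightarrow> Mid12 i | Dn i \<Rightarrow> Outer3 (Dn i))"
| "embed23 (Mid i) = Mid23 i"

fun embed_upper :: "glued_vertex \<Rightarrow> stack_vertex" where
  "embed_upper (Outer v) = Outer3 v" | "embed_upper (Mid i) = Mid12 i"

fun embed_lower :: "glued_vertex \<Rightarrow> stack_vertex" where
  "embed_lower (Outer v) = Outer3 v" | "embed_lower (Mid i) = Mid23 i"

definition stack_blocks :: "diagram \<Rightarrow> diagram \<Rightarrow> diagram \<Rightarrow> stack_vertex set set" where
  "stack_blocks d1 d2 d3 = (`) layer1 ` d1 \<union> (`) layer2 ` d2 \<union> (`) layer3 ` d3"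

lemma inj_embed: "inj embed12" "inj embed23" "inj embed_upper" "inj embed_lower"
proof -
  show "inj embed12"
  proof (rule injI)
    fix x y show "embed12 x = embed12 y \<Longrightarrow> x = y"
      by (cases x; cases y) (auto split: vertex.splits)
  qed
  show "inj embed23"
  proof (rule injI)
    fix x y show "embed23 x = embed23 y \<Longrightarrow> x = y"
      by (cases x; cases y) (auto split: vertex.splits)
  qed
  show "inj embed_upper"
  proof (rule injI)
    fix x y show "embed_upper x = embed_upper y \<Longrightarrow> x = y" by (cases x; cases y) auto
  qed
  show "inj embed_lower"
  proof (rule injI)
    fix x y show "embed_lower x = embed_lower y \<Longrightarrow> x = y" by (cases x; cases y) auto
  qed
qed

lemma image_blocks_glued:
  "(`) f ` glued_blocks d1 d2 = (`) (f \<circ> glue_first) ` d1 \<union> (`) (f \<circ> glue_second) ` d2"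
  unfolding glued_blocks_def by (simp add: image_Un image_image image_comp comp_def)

lemma embed_glue:
  "embed12 \<circ> glue_first = layer1" "embed12 \<circ> glue_second = layer2"
  "embed23 \<circ> glue_first = layer2" "embed23 \<circ> glue_second = layer3"
  "embed_upper \<circ> glue_first = layer1" "embed_upper \<circ> glue_second = embed23 \<circ> Outer"
  "embed_lower \<circ> glue_first = embed12 \<circ> Outer" "embed_lower \<circ> glue_second = layer3"
  by (rule ext, case_tac x, simp_all)+

lemma finite_comps: "finite B \<Longrightarrow> finite (\<Union>B) \<Longrightarrow> finite (comps B)"
  using comps_cover[of B] finite_UnionD by metis

text \<open>
  Both sides are computed from the same stack of three diagrams.
\<close>

lemma diagram_comp_assoc:
  assumes "finite (comps (stack_blocks d1 d2 d3))"
  shows "diagram_comp (diagram_comp d1 d2) d3 = diagram_comp d1 (diagram_comp d2 d3)"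
    and "loops d1 d2 + loops (diagram_comp d1 d2) d3 = loops d2 d3 + loops d1 (diagram_comp d2 d3)"
proof -
  let ?S = "stack_blocks d1 d2 d3"
  have mids: "embed12 ` range Mid \<union> embed_lower ` range Mid =
      embed23 ` range Mid \<union> embed_upper ` range Mid"
    by (auto simp: image_image)
  have l3: "layer3 x \<notin> embed12 ` range Mid" for x by (cases x) auto
  have l1: "layer1 x \<notin> embed23 ` range Mid" for x by (cases x) auto
  have L: "\<Union>((`) layer3 ` d3) \<inter> embed12 ` range Mid = {}" using l3 by blast
  have R: "\<Union>((`) layer1 ` d1) \<inter> embed23 ` range Mid = {}" using l1 by blast
  note left = two_stage_gluing[of embed12 embed_lower Outer3, OF inj_embed(1,4) _ _ L _ _ assms,
      of d1 d2 "diagram_comp d1 d2" d3]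
  note right = two_stage_gluing[of embed23 embed_upper Outer3, OF inj_embed(2,3) _ _ R _ _ assms,
      of d2 d3 d1 "diagram_comp d2 d3"]
  have *: "diagram_comp (diagram_comp d1 d2) d3 = (-`) Outer3 ` comps ?S - {{}}"
    by (rule left) (simp_all add: image_blocks_glued embed_glue stack_blocks_def)
  have **: "diagram_comp d1 (diagram_comp d2 d3) = (-`) Outer3 ` comps ?S - {{}}"
    by (rule right) (simp_all add: image_blocks_glued embed_glue stack_blocks_def Un_ac)
  show "diagram_comp (diagram_comp d1 d2) d3 = diagram_comp d1 (diagram_comp d2 d3)"
    using * ** by simp
  have *: "loops d1 d2 + loops (diagram_comp d1 d2) d3 =
      card {C \<in> comps ?S. C \<subseteq> embed12 ` range Mid \<union> embed_lower ` range Mid}"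
    by (rule left) (simp_all add: image_blocks_glued embed_glue stack_blocks_def)
  have **: "loops d2 d3 + loops d1 (diagram_comp d2 d3) =
      card {C \<in> comps ?S. C \<subseteq> embed23 ` range Mid \<union> embed_upper ` range Mid}"
    by (rule right) (simp_all add: image_blocks_glued embed_glue stack_blocks_def Un_ac)
  show "loops d1 d2 + loops (diagram_comp d1 d2) d3 = loops d2 d3 + loops d1 (diagram_comp d2 d3)"
    using * ** mids by simp
qed

section \<open>Brauer diagrams are closed under gluing\<close>

definition vertices :: "nat \<Rightarrow> vertex set" where
  "vertices n = Up ` {1..n} \<union> Dn ` {1..n}"

lemma brauer_diagrams_iff:
  "d \<in> brauer_diagrams n \<longleftrightarrow> partition_on (vertices n) d \<and> (\<forall>b\<in>d. card b = 2)"
  by (simp add: brauer_diagrams_def vertices_def)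

lemma finite_vertices [simp]: "finite (vertices n)"
  by (simp add: vertices_def)

lemma brauer_finite: "d \<in> brauer_diagrams n \<Longrightarrow> finite d"
  using finite_elements[OF finite_vertices] brauer_diagrams_iff by blast

lemma brauer_Union: "d \<in> brauer_diagrams n \<Longrightarrow> \<Union>d = vertices n"
  using partition_onD1 brauer_diagrams_iff by blast

lemma finite_brauer_diagrams: "finite (brauer_diagrams n)"
proof (rule finite_subset)
  show "brauer_diagrams n \<subseteq> Pow (Pow (vertices n))" using brauer_Union by blast
qed simp

lemma Union_glued_blocks:
  assumes "d1 \<in> brauer_diagrams n" "d2 \<in> brauer_diagrams n"
  shows "\<Union>(glued_blocks d1 d2) = Outer ` vertices n \<union> Mid ` {1..n}"
proof -
  have "\<Union>(glued_blocks d1 d2) = glue_first ` \<Union>d1 \<union> glue_second ` \<Union>d2"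
    unfolding glued_blocks_def by auto
  also have "\<dots> = Outer ` vertices n \<union> Mid ` {1..n}"
    unfolding brauer_Union[OF assms(1)] brauer_Union[OF assms(2)] vertices_def
    by (auto simp: image_Un image_image)
  finally show ?thesis .
qed

lemma finite_comps_stack_blocks:
  assumes "d1 \<in> brauer_diagrams n" "d2 \<in> brauer_diagrams n" "d3 \<in> brauer_diagrams n"
  shows "finite (comps (stack_blocks d1 d2 d3))"
proof (rule finite_comps)
  show "finite (stack_blocks d1 d2 d3)"
    using assms by (simp add: stack_blocks_def brauer_finite)
  have "\<Union>(stack_blocks d1 d2 d3) = layer1 ` \<Union>d1 \<union> layer2 ` \<Union>d2 \<union> layer3 ` \<Union>d3"
    unfolding stack_blocks_def by auto
  then show "finite (\<Union>(stack_blocks d1 d2 d3))"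
    using assms by (simp add: brauer_Union)
qed

lemma inj_glue: "inj glue_first" "inj glue_second"
proof -
  show "inj glue_first"
  proof (rule injI)
    fix x y show "glue_first x = glue_first y \<Longrightarrow> x = y" by (cases x; cases y) auto
  qed
  show "inj glue_second"
  proof (rule injI)
    fix x y show "glue_second x = glue_second y \<Longrightarrow> x = y" by (cases x; cases y) auto
  qed
qed

text \<open>
  \<open>X\<close> is the disjoint union of the blocks inside it, each of which has two points.
\<close>

lemma card_saturated:
  assumes "d \<in> brauer_diagrams n" and "X \<subseteq> vertices n" and "\<And>b. b \<in> d \<Longrightarrow> b \<inter> X \<noteq> {} \<Longrightarrow> b \<subseteq> X"
  shows "card X = 2 * card {b \<in> d. b \<subseteq> X}"
proof -
  have "X = \<Union>{b \<in> d. b \<subseteq> X}"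
  proof
    show "X \<subseteq> \<Union>{b \<in> d. b \<subseteq> X}"
    proof
      fix x assume x: "x \<in> X"
      then have "x \<in> \<Union>d" using brauer_Union[OF assms(1)] assms(2) by auto
      then obtain b where "b \<in> d" "x \<in> b" by auto
      then show "x \<in> \<Union>{b \<in> d. b \<subseteq> X}" using assms(3)[of b] x by auto
    qed
  qed auto
  moreover have "card (\<Union>{b \<in> d. b \<subseteq> X}) = (\<Sum>b\<in>{b \<in> d. b \<subseteq> X}. card b)"
  proof (rule card_Union_disjoint)
    show "pairwise disjnt {b \<in> d. b \<subseteq> X}"
      using assms(1) by (auto simp: brauer_diagrams_iff partition_on_def pairwise_def disjoint_def)
    show "finite b" if "b \<in> {b \<in> d. b \<subseteq> X}" for b
      using that assms(1) by (auto simp: brauer_diagrams_iff intro: card_ge_0_finite)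
  qed
  moreover have "(\<Sum>b\<in>{b \<in> d. b \<subseteq> X}. card b) = (\<Sum>b\<in>{b \<in> d. b \<subseteq> X}. 2)"
    using assms(1) by (intro sum.cong) (auto simp: brauer_diagrams_iff)
  ultimately show ?thesis by simp
qed

text \<open>
  Let the component \<open>C\<close> have \<open>u\<close> upper outer, \<open>l\<close> lower outer and \<open>m\<close> inner vertices. The blocks of
  \<open>d1\<close> inside \<open>C\<close> match its \<open>u + m\<close> vertices in the first diagram and those of \<open>d2\<close> its \<open>m + l\<close>
  vertices in the second, so \<open>u + m\<close> and \<open>m + l\<close> are even and \<open>C\<close> has at most
  \<open>(u + m) / 2 + (m + l) / 2\<close> edges. By \<open>comps_edge_count\<close>,
  \<open>u + m + l \<le> (u + m) / 2 + (m + l) / 2 + 1\<close>, that is \<open>u + l \<le> 2\<close>, where \<open>u + l\<close> is even and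
  positive.
\<close>

lemma card_component:
  assumes d1: "d1 \<in> brauer_diagrams n" and d2: "d2 \<in> brauer_diagrams n"
    and C: "C \<in> comps (glued_blocks d1 d2)" and ne: "Outer -` C \<noteq> {}"
  shows "card (Outer -` C) = 2"
proof -
  let ?G = "glued_blocks d1 d2"
  let ?U = "{i. Outer (Up i) \<in> C}" and ?D = "{i. Outer (Dn i) \<in> C}" and ?M = "{i. Mid i \<in> C}"
  have sub: "C \<subseteq> Outer ` vertices n \<union> Mid ` {1..n}"
    using comps_subset[OF C] Union_glued_blocks[OF d1 d2] by simp
  have "finite (Outer ` vertices n \<union> Mid ` {1..n})" by simp
  then have finC: "finite C" by (rule finite_subset[OF sub])
  have "?U \<subseteq> {1..n}" "?D \<subseteq> {1..n}" "?M \<subseteq> {1..n}" using sub by (auto simp: vertices_def)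
  then have fin: "finite ?U" "finite ?D" "finite ?M" by (auto intro: finite_subset)
  have outer: "Outer -` C = Up ` ?U \<union> Dn ` ?D"
  proof (rule Set.set_eqI)
    fix x show "x \<in> Outer -` C \<longleftrightarrow> x \<in> Up ` ?U \<union> Dn ` ?D" by (cases x) auto
  qed
  have first: "glue_first -` C = Up ` ?U \<union> Dn ` ?M"
  proof (rule Set.set_eqI)
    fix x show "x \<in> glue_first -` C \<longleftrightarrow> x \<in> Up ` ?U \<union> Dn ` ?M" by (cases x) auto
  qed
  have second: "glue_second -` C = Up ` ?M \<union> Dn ` ?D"
  proof (rule Set.set_eqI)
    fix x show "x \<in> glue_second -` C \<longleftrightarrow> x \<in> Up ` ?M \<union> Dn ` ?D" by (cases x) auto
  qed
  have "C = Outer ` (Outer -` C) \<union> Mid ` ?M"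
  proof (rule Set.set_eqI)
    fix x show "x \<in> C \<longleftrightarrow> x \<in> Outer ` (Outer -` C) \<union> Mid ` ?M" by (cases x) auto
  qed
  then have "card C = card (Outer ` (Outer -` C) \<union> Mid ` ?M)" by simp
  also have "\<dots> = card (Outer -` C) + card ?M"
    using fin outer by (subst card_Un_disjoint) (auto simp: card_image inj_on_def)
  finally have card_C: "card C = card (Outer -` C) + card ?M" .
  have two: "card (Up ` S \<union> Dn ` T) = card S + card T" if "finite S" "finite T" for S T
    using that by (subst card_Un_disjoint) (auto simp: card_image inj_on_def)
  have "card (glue_first -` C) = 2 * card {b \<in> d1. b \<subseteq> glue_first -` C}"
  proof (rule card_saturated[OF d1])
    show "glue_first -` C \<subseteq> vertices n" unfolding first vertices_def using sub
      by (auto simp: vertices_def)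
    fix b assume "b \<in> d1" "b \<inter> glue_first -` C \<noteq> {}"
    then have "glue_first ` b \<in> ?G" "glue_first ` b \<inter> C \<noteq> {}" by (auto simp: glued_blocks_def)
    then show "b \<subseteq> glue_first -` C" using comps_block[OF C] by blast
  qed
  moreover have "card (glue_second -` C) = 2 * card {b \<in> d2. b \<subseteq> glue_second -` C}"
  proof (rule card_saturated[OF d2])
    show "glue_second -` C \<subseteq> vertices n" unfolding second vertices_def using sub
      by (auto simp: vertices_def)
    fix b assume "b \<in> d2" "b \<inter> glue_second -` C \<noteq> {}"
    then have "glue_second ` b \<in> ?G" "glue_second ` b \<inter> C \<noteq> {}" by (auto simp: glued_blocks_def)
    then show "b \<subseteq> glue_second -` C" using comps_block[OF C] by blast
  qed
  moreover have "card C \<le> card {b \<in> ?G. b \<subseteq> C} + 1"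
  proof (rule comps_edge_count[OF C _ finC])
    show "finite ?G" using d1 d2 by (simp add: glued_blocks_def brauer_finite)
    show "card b = 2" if "b \<in> ?G" for b
      using that d1 d2 inj_glue
      by (auto simp: glued_blocks_def brauer_diagrams_iff card_image inj_on_subset[OF _ subset_UNIV])
  qed
  \<comment> \<open>Only an inequality: two diagrams may contribute the same edge between inner vertices.\<close>
  moreover have "card {b \<in> ?G. b \<subseteq> C} \<le>
      card {b \<in> d1. b \<subseteq> glue_first -` C} + card {b \<in> d2. b \<subseteq> glue_second -` C}"
  proof -
    have "{b \<in> ?G. b \<subseteq> C} = (`) glue_first ` {b \<in> d1. b \<subseteq> glue_first -` C} \<union>
        (`) glue_second ` {b \<in> d2. b \<subseteq> glue_second -` C}"
      unfolding glued_blocks_def image_subset_iff_subset_vimage[symmetric] by blast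
    then have "card {b \<in> ?G. b \<subseteq> C} \<le> card ((`) glue_first ` {b \<in> d1. b \<subseteq> glue_first -` C}) +
        card ((`) glue_second ` {b \<in> d2. b \<subseteq> glue_second -` C})"
      by (simp add: card_Un_le)
    moreover have "card ((`) glue_first ` {b \<in> d1. b \<subseteq> glue_first -` C}) \<le>
        card {b \<in> d1. b \<subseteq> glue_first -` C}"
      by (rule card_image_le) (simp add: brauer_finite[OF d1])
    moreover have "card ((`) glue_second ` {b \<in> d2. b \<subseteq> glue_second -` C}) \<le>
        card {b \<in> d2. b \<subseteq> glue_second -` C}"
      by (rule card_image_le) (simp add: brauer_finite[OF d2])
    ultimately show ?thesis by linarith
  qed
  moreover have "card (Outer -` C) \<noteq> 0" using ne fin outer by simp
  ultimately show ?thesis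
    unfolding card_C outer first second two[OF fin(1,2)] two[OF fin(1,3)] two[OF fin(3,2)]
    by presburger
qed

lemma diagram_comp_closed:
  assumes d1: "d1 \<in> brauer_diagrams n" and d2: "d2 \<in> brauer_diagrams n"
  shows "diagram_comp d1 d2 \<in> brauer_diagrams n"
  unfolding brauer_diagrams_iff
proof
  have "Outer -` \<Union>(glued_blocks d1 d2) = vertices n"
    unfolding Union_glued_blocks[OF assms] by auto
  then show "partition_on (vertices n) (diagram_comp d1 d2)"
    unfolding diagram_comp_comps
    using partition_on_vimage[OF partition_comps, of Outer "glued_blocks d1 d2"] by simp
  show "\<forall>b\<in>diagram_comp d1 d2. card b = 2"
    unfolding diagram_comp_comps using card_component[OF assms] by auto
qed


section \<open>Permutation diagrams\<close>

fun map_up :: "(nat \<Rightarrow> nat) \<Rightarrow> vertex \<Rightarrow> vertex" where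
  "map_up f (Up i) = Up (f i)" | "map_up f (Dn i) = Dn i"

fun map_dn :: "(nat \<Rightarrow> nat) \<Rightarrow> vertex \<Rightarrow> vertex" where
  "map_dn f (Up i) = Up i" | "map_dn f (Dn i) = Dn (f i)"

text \<open>
  Position \<open>j\<close> below is joined to \<open>p j\<close> above, so that gluing corresponds to composition of maps in
  the same order.
\<close>

definition perm_diagram :: "nat \<Rightarrow> (nat \<Rightarrow> nat) \<Rightarrow> diagram" where
  "perm_diagram n p = {{Up (p j), Dn j} |j. j \<in> {1..n}}"

lemma perm_diagram_image: "perm_diagram n p = (\<lambda>j. {Up (p j), Dn j}) ` {1..n}"
  by (auto simp: perm_diagram_def)

lemma perm_diagram_closed:
  assumes p: "p permutes {1..n}"
  shows "perm_diagram n p \<in> brauer_diagrams n"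
proof -
  have "\<Union>(perm_diagram n p) = Up ` p ` {1..n} \<union> Dn ` {1..n}"
    unfolding perm_diagram_image by auto
  then have "\<Union>(perm_diagram n p) = vertices n"
    by (simp only: permutes_image[OF p] vertices_def)
  then show ?thesis
    unfolding brauer_diagrams_iff using permutes_inj[OF p]
    by (intro conjI partition_onI) (auto simp: perm_diagram_image disjnt_def dest: injD)
qed

text \<open>
  One of the two glued diagrams is \<open>d\<close>, embedded by \<open>s\<close>, and the other only provides threads
  leading to vertices of \<open>d\<close>; \<open>r\<close> pulls every vertex along its thread back to \<open>d\<close>. The components are
  then the fibres of \<open>r\<close> over the blocks of \<open>d\<close>. Surjectivity of \<open>r\<close> on outer vertices says that
  every fibre reaches the boundary, so no loop arises.
\<close>

lemma glue_retract:
  assumes part: "partition_on V d" and blocks: "(`) s ` d \<subseteq> glued_blocks d1 d2"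
    and rs: "\<And>a. r (s a) = a"
    and covered: "\<And>l. l \<in> glued_blocks d1 d2 \<Longrightarrow> l \<notin> (`) s ` d \<Longrightarrow> \<exists>a\<in>V. l \<subseteq> r -` {a}"
    and support: "\<Union>(glued_blocks d1 d2) = r -` V"
    and linked: "\<And>x. r x \<in> V \<Longrightarrow> \<exists>l\<in>glued_blocks d1 d2. x \<in> l \<and> s (r x) \<in> l"
    and surj: "surj (r \<circ> Outer)"
  shows "diagram_comp d1 d2 = (-`) (r \<circ> Outer) ` d" and "loops d1 d2 = 0"
proof -
  let ?G = "glued_blocks d1 d2"
  have ne: "b \<noteq> {}" if "b \<in> d" for b using partition_onD3[OF part] that by auto
  have outer: "\<exists>v. Outer v \<in> r -` b" if "b \<in> d" for b
  proof -
    obtain a where "a \<in> b" using ne \<open>b \<in> d\<close> by auto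
    then show ?thesis using surjD[OF surj, of a] by auto
  qed
  have V: "V = \<Union>d" by (rule partition_onD1[OF part])
  have comps: "comps ?G = (-`) r ` d"
  proof (rule comps_eqI)
    have "(-`) r ` d - {{}} = (-`) r ` d"
      using outer by fastforce
    then show "partition_on (r -` V) ((-`) r ` d)"
      using partition_on_vimage[OF part, of r] by simp
    show "\<Union>?G = r -` V" by (rule support)
    show "\<exists>p\<in>(-`) r ` d. l \<subseteq> p" if l: "l \<in> ?G" "l \<noteq> {}" for l
    proof (cases "l \<in> (`) s ` d")
      case True
      then obtain b where "b \<in> d" "l = s ` b" by auto
      then have "l \<subseteq> r -` b" using rs by auto
      then show ?thesis using \<open>b \<in> d\<close> by auto
    next
      case False
      then obtain a where "a \<in> V" and la: "l \<subseteq> r -` {a}" using covered[OF l(1)] by auto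
      then obtain b where "b \<in> d" "a \<in> b" using V by auto
      then have "l \<subseteq> r -` b" using la by auto
      then show ?thesis using \<open>b \<in> d\<close> by auto
    qed
    show "(x, y) \<in> conn ?G" if p: "p \<in> (-`) r ` d" "x \<in> p" "y \<in> p" for p x y
    proof -
      obtain b where b: "b \<in> d" "r x \<in> b" "r y \<in> b" using p by auto
      then have "r x \<in> V" "r y \<in> V" using V by auto
      then have xy: "(x, s (r x)) \<in> conn ?G" "(y, s (r y)) \<in> conn ?G"
        using linked conn_block by metis+
      have "s ` b \<in> ?G" using blocks b(1) by auto
      then have "(s (r x), s (r y)) \<in> conn ?G" using b(2,3) by (intro conn_block) auto
      then show ?thesis by (rule conn_trans[OF conn_trans[OF xy(1)] conn_sym[OF xy(2)]])
    qed
  qed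
  have "Outer -` (r -` b) = (r \<circ> Outer) -` b" for b by auto
  then have "(-`) Outer ` comps ?G = (-`) (r \<circ> Outer) ` d"
    unfolding comps image_image by (simp only:)
  moreover have "{} \<notin> (-`) (r \<circ> Outer) ` d" using outer by fastforce
  ultimately show "diagram_comp d1 d2 = (-`) (r \<circ> Outer) ` d"
    unfolding diagram_comp_comps by simp
  have "\<not> C \<subseteq> range Mid" if "C \<in> comps ?G" for C
    using that outer unfolding comps by fastforce
  then have "{C \<in> comps ?G. C \<subseteq> range Mid} = {}" by auto
  then show "loops d1 d2 = 0" unfolding loops_comps by (simp only: card.empty)
qed

text \<open>
  Gluing a permutation diagram on top renames the upper vertices: the threads of the permutation
  diagram retract onto \<open>d\<close>.
\<close>

lemma
  assumes p: "p permutes {1..n}" and d: "d \<in> brauer_diagrams n"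
  shows perm_diagram_comp: "diagram_comp (perm_diagram n p) d = (`) (map_up p) ` d"
    and loops_perm_left: "loops (perm_diagram n p) d = 0"
proof -
  define q where "q = inv_into UNIV p"
  define r where "r x = (case x of Outer v \<Rightarrow> map_up q v | Mid i \<Rightarrow> Up i)" for x
  have rO: "r \<circ> Outer = map_up q" by (rule ext) (simp add: r_def)
  have inv: "q (p i) = i" "p (q i) = i" for i
    unfolding q_def using permutes_inverses[OF p] by auto
  have part: "partition_on (vertices n) d" using d brauer_diagrams_iff by auto
  let ?G = "glued_blocks (perm_diagram n p) d"
  have G: "?G = (\<lambda>j. {Outer (Up (p j)), Mid j}) ` {1..n} \<union> (`) glue_second ` d"
    by (simp add: glued_blocks_def perm_diagram_image image_image)
  have range: "q i \<in> {1..n} \<longleftrightarrow> i \<in> {1..n}" for i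
    unfolding q_def by (rule permutes_in_image[OF permutes_inv[OF p]])
  note * = glue_retract[OF part, of glue_second "perm_diagram n p" d r]
  have 1: "(`) glue_second ` d \<subseteq> ?G" unfolding G by simp
  have 2: "r (glue_second a) = a" for a by (cases a) (simp_all add: r_def)
  have 3: "\<exists>a\<in>vertices n. l \<subseteq> r -` {a}" if l: "l \<in> ?G" "l \<notin> (`) glue_second ` d" for l
  proof -
    obtain j where "j \<in> {1..n}" "l = {Outer (Up (p j)), Mid j}" using l unfolding G by auto
    then show ?thesis by (intro bexI[of _ "Up j"]) (auto simp: r_def inv vertices_def)
  qed
  have 4: "\<Union>?G = r -` vertices n"
    unfolding Union_glued_blocks[OF perm_diagram_closed[OF p] d]
  proof (rule Set.set_eqI)
    fix x show "x \<in> Outer ` vertices n \<union> Mid ` {1..n} \<longleftrightarrow> x \<in> r -` vertices n"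
    proof (cases x)
      case (Outer v)
      then show ?thesis using range by (cases v) (auto simp: r_def vertices_def image_iff)
    qed (auto simp: r_def vertices_def)
  qed
  have 5: "\<exists>l\<in>?G. x \<in> l \<and> glue_second (r x) \<in> l" if x: "r x \<in> vertices n" for x
  proof (cases "\<exists>i. x = Outer (Up i)")
    case True
    then obtain i where i: "x = Outer (Up i)" by auto
    then have "q i \<in> {1..n}" using x by (auto simp: r_def vertices_def)
    then have "{Outer (Up (p (q i))), Mid (q i)} \<in> ?G" unfolding G by auto
    then show ?thesis unfolding inv by (rule bexI[rotated]) (simp add: i r_def)
  next
    case False
    then have "glue_second (r x) = x"
      by (cases x; cases "r x") (auto simp: r_def split: glued_vertex.splits elim!: map_up.elims)
    moreover obtain b where "b \<in> d" "r x \<in> b" using x brauer_Union[OF d] by auto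
    ultimately show ?thesis unfolding G by (intro bexI[of _ "glue_second ` b"]) (auto intro: rev_image_eqI)
  qed
  have 6: "surj (r \<circ> Outer)"
  proof (rule surjI[of _ "map_up p"])
    fix v show "(r \<circ> Outer) (map_up p v) = v" by (cases v) (simp_all add: r_def inv)
  qed
  have vimage: "map_up q -` b = map_up p ` b" for b
  proof (rule Set.set_eqI)
    have "map_up p (map_up q v) = v" "map_up q (map_up p v) = v" for v
      by (cases v; simp add: inv)+
    then show "v \<in> map_up q -` b \<longleftrightarrow> v \<in> map_up p ` b" for v
      by (metis imageE imageI vimage_eq)
  qed
  show "diagram_comp (perm_diagram n p) d = (`) (map_up p) ` d"
    unfolding vimage[symmetric] rO[symmetric] by (rule *(1)[OF 1 2 3 4 5 6])
  show "loops (perm_diagram n p) d = 0"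
    by (rule *(2)[OF 1 2 3 4 5 6])
qed

text \<open>
  Below \<open>d\<close>, position \<open>j\<close> is joined to the lower vertex \<open>p j\<close> of \<open>d\<close>, so lower vertices are pulled
  back along \<open>p\<close>; hence the preimage where the gluing on top has an image.
\<close>

lemma
  assumes p: "p permutes {1..n}" and d: "d \<in> brauer_diagrams n"
  shows comp_perm_diagram: "diagram_comp d (perm_diagram n p) = (-`) (map_dn p) ` d"
    and loops_perm_right: "loops d (perm_diagram n p) = 0"
proof -
  define r where "r x = (case x of Outer v \<Rightarrow> map_dn p v | Mid i \<Rightarrow> Dn i)" for x
  have rO: "r \<circ> Outer = map_dn p" by (rule ext) (simp add: r_def)
  have part: "partition_on (vertices n) d" using d brauer_diagrams_iff by auto
  let ?G = "glued_blocks d (perm_diagram n p)"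
  have G: "?G = (`) glue_first ` d \<union> (\<lambda>j. {Mid (p j), Outer (Dn j)}) ` {1..n}"
    by (simp add: glued_blocks_def perm_diagram_image image_image)
  have range: "p i \<in> {1..n} \<longleftrightarrow> i \<in> {1..n}" for i
    by (rule permutes_in_image[OF p])
  note * = glue_retract[OF part, of glue_first d "perm_diagram n p" r]
  have 1: "(`) glue_first ` d \<subseteq> ?G" unfolding G by simp
  have 2: "r (glue_first a) = a" for a by (cases a) (simp_all add: r_def)
  have 3: "\<exists>a\<in>vertices n. l \<subseteq> r -` {a}" if l: "l \<in> ?G" "l \<notin> (`) glue_first ` d" for l
  proof -
    obtain j where j: "j \<in> {1..n}" "l = {Mid (p j), Outer (Dn j)}" using l unfolding G by auto
    then have "Dn (p j) \<in> vertices n" using range unfolding vertices_def by blast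
    then show ?thesis using j by (intro bexI[of _ "Dn (p j)"]) (auto simp: r_def)
  qed
  have 4: "\<Union>?G = r -` vertices n"
    unfolding Union_glued_blocks[OF d perm_diagram_closed[OF p]]
  proof (rule Set.set_eqI)
    fix x show "x \<in> Outer ` vertices n \<union> Mid ` {1..n} \<longleftrightarrow> x \<in> r -` vertices n"
    proof (cases x)
      case (Outer v)
      then show ?thesis using range by (cases v) (auto simp: r_def vertices_def image_iff)
    qed (auto simp: r_def vertices_def)
  qed
  have 5: "\<exists>l\<in>?G. x \<in> l \<and> glue_first (r x) \<in> l" if x: "r x \<in> vertices n" for x
  proof (cases "\<exists>i. x = Outer (Dn i)")
    case True
    then obtain i where i: "x = Outer (Dn i)" by auto
    then have "p i \<in> {1..n}" using x by (auto simp: r_def vertices_def)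
    then have "{Mid (p i), Outer (Dn i)} \<in> ?G" unfolding G range by auto
    then show ?thesis by (rule bexI[rotated]) (simp add: i r_def)
  next
    case False
    then have "glue_first (r x) = x"
      by (cases x; cases "r x") (auto simp: r_def split: glued_vertex.splits elim!: map_dn.elims)
    moreover obtain b where "b \<in> d" "r x \<in> b" using x brauer_Union[OF d] by auto
    ultimately show ?thesis unfolding G by (intro bexI[of _ "glue_first ` b"]) (auto intro: rev_image_eqI)
  qed
  have 6: "surj (r \<circ> Outer)"
  proof (rule surjI[of _ "map_dn (inv_into UNIV p)"])
    fix v show "(r \<circ> Outer) (map_dn (inv_into UNIV p) v) = v"
      by (cases v) (simp_all add: r_def permutes_inverses[OF p])
  qed
  show "diagram_comp d (perm_diagram n p) = (-`) (map_dn p) ` d"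
    using *(1)[OF 1 2 3 4 5 6] unfolding rO by simp
  show "loops d (perm_diagram n p) = 0"
    by (rule *(2)[OF 1 2 3 4 5 6])
qed

lemma id_diagram_perm: "id_diagram n = perm_diagram n id"
  by (simp add: id_diagram_def perm_diagram_def)

lemma id_diagram_closed: "id_diagram n \<in> brauer_diagrams n"
  unfolding id_diagram_perm by (rule perm_diagram_closed[OF permutes_id])

lemma
  assumes d: "d \<in> brauer_diagrams n"
  shows id_diagram_comp: "diagram_comp (id_diagram n) d = d"
    and comp_id_diagram: "diagram_comp d (id_diagram n) = d"
    and loops_id_left: "loops (id_diagram n) d = 0"
    and loops_id_right: "loops d (id_diagram n) = 0"
proof -
  have "map_up id v = v" "map_dn id v = v" for v by (cases v; simp)+
  then have "map_up id = id" "map_dn id = id" by auto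
  then show "diagram_comp (id_diagram n) d = d" "diagram_comp d (id_diagram n) = d"
    unfolding id_diagram_perm
    using perm_diagram_comp[OF permutes_id d] comp_perm_diagram[OF permutes_id d] by simp_all
  show "loops (id_diagram n) d = 0" "loops d (id_diagram n) = 0"
    unfolding id_diagram_perm by (rule loops_perm_left[OF permutes_id d] loops_perm_right[OF permutes_id d])+
qed

lemma vimage_map_dn:
  assumes "bij p"
  shows "map_dn p -` {Up i, Dn (p j)} = {Up i, Dn j}"
    and "map_dn p -` {Up i, Up j} = {Up i, Up j}"
    and "map_dn p -` {Dn (p i), Dn (p j)} = {Dn i, Dn j}"
proof -
  have [simp]: "p k = p l \<longleftrightarrow> k = l" for k l
    using assms by (metis bij_pointE)
  have "map_dn p v = Up l \<longleftrightarrow> v = Up l" "map_dn p v = Dn (p l) \<longleftrightarrow> v = Dn l" for v l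
    by (cases v; simp)+
  then show "map_dn p -` {Up i, Dn (p j)} = {Up i, Dn j}"
    "map_dn p -` {Up i, Up j} = {Up i, Up j}"
    "map_dn p -` {Dn (p i), Dn (p j)} = {Dn i, Dn j}" by auto
qed

lemma perm_diagram_mult:
  assumes p: "p permutes {1..n}" and q: "q permutes {1..n}"
  shows "diagram_comp (perm_diagram n p) (perm_diagram n q) = perm_diagram n (p \<circ> q)"
  unfolding perm_diagram_comp[OF p perm_diagram_closed[OF q]]
  by (simp add: perm_diagram_image image_image)

section \<open>Cup-cap diagrams\<close>

text \<open>
  The diagram \<open>e\<^sub>i\<close> for an arbitrary pair \<open>a\<close>, \<open>b\<close> instead of neighbours, the form in which it can be
  conjugated by permutations.
\<close>

definition cupcap :: "nat \<Rightarrow> nat \<Rightarrow> nat \<Rightarrow> diagram" where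
  "cupcap n a b = {{Up a, Up b}, {Dn a, Dn b}} \<union> {{Up j, Dn j} |j. j \<in> {1..n} - {a, b}}"

lemma cupcap_image:
  "cupcap n a b = {{Up a, Up b}, {Dn a, Dn b}} \<union> (\<lambda>j. {Up j, Dn j}) ` ({1..n} - {a, b})"
  by (simp only: cupcap_def Setcompr_eq_image)

lemma cupcap_commute: "cupcap n a b = cupcap n b a"
  by (simp add: cupcap_def insert_commute)

lemma cupcap_closed:
  assumes "a \<in> {1..n}" "b \<in> {1..n}" "a \<noteq> b"
  shows "cupcap n a b \<in> brauer_diagrams n"
  unfolding brauer_diagrams_iff
proof (intro conjI partition_onI)
  show "\<Union>(cupcap n a b) = vertices n"
    unfolding cupcap_image vertices_def using assms by auto
  show "\<forall>c\<in>cupcap n a b. card c = 2" using assms by (auto simp: cupcap_image)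
qed (use assms in \<open>auto simp: cupcap_image disjnt_def\<close>)

text \<open>
  Both sides join \<open>a\<close> to \<open>b\<close> below, \<open>p a\<close> to \<open>p b\<close> above, and \<open>p j\<close> above to \<open>j\<close> below for the
  other \<open>j\<close>.
\<close>

lemma perm_cupcap:
  assumes p: "p permutes {1..n}" and ab: "a \<in> {1..n}" "b \<in> {1..n}" "a \<noteq> b"
  shows "diagram_comp (perm_diagram n p) (cupcap n a b) =
    diagram_comp (cupcap n (p a) (p b)) (perm_diagram n p)"
proof -
  have bij: "bij p" by (rule permutes_bij[OF p])
  have img: "p ` ({1..n} - {a, b}) = {1..n} - {p a, p b}"
    using permutes_image[OF p] bij_is_inj[OF bij] by (simp add: image_set_diff)
  have "p a \<in> {1..n}" "p b \<in> {1..n}" "p a \<noteq> p b"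
    using ab permutes_in_image[OF p] injD[OF bij_is_inj[OF bij]] by blast+
  note cl = cupcap_closed[OF this]
  have "(`) (map_up p) ` cupcap n a b =
      {{Up (p a), Up (p b)}, {Dn a, Dn b}} \<union> (\<lambda>j. {Up (p j), Dn j}) ` ({1..n} - {a, b})"
    by (simp add: cupcap_image image_image)
  also have "\<dots> = (-`) (map_dn p) ` cupcap n (p a) (p b)"
    unfolding cupcap_image img[symmetric]
    by (simp add: image_image vimage_map_dn[OF bij])
  finally show ?thesis
    by (simp only: perm_diagram_comp[OF p cupcap_closed[OF ab]] comp_perm_diagram[OF p cl])
qed

text \<open>
  The result is symmetric in the two pairs, which is why the factors commute. No loop arises
  because at \<open>a\<close>, \<open>b\<close> and at \<open>c\<close>, \<open>d\<close> one of the factors has straight lines to the boundary.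
\<close>

lemma
  assumes "a \<in> {1..n}" "b \<in> {1..n}" "c \<in> {1..n}" "d \<in> {1..n}" and dist: "distinct [a, b, c, d]"
  shows cupcap_mult: "diagram_comp (cupcap n a b) (cupcap n c d) =
      {{Up a, Up b}, {Dn a, Dn b}, {Up c, Up d}, {Dn c, Dn d}} \<union>
      {{Up j, Dn j} |j. j \<in> {1..n} - {a, b, c, d}}"
    and loops_cupcap: "loops (cupcap n a b) (cupcap n c d) = 0"
proof -
  let ?G = "glued_blocks (cupcap n a b) (cupcap n c d)"
  let ?J = "{1..n} - {a, b, c, d}"
  let ?P = "{{Outer (Up a), Outer (Up b)}, {Mid a, Mid b, Outer (Dn a), Outer (Dn b)},
      {Outer (Up c), Outer (Up d), Mid c, Mid d}, {Outer (Dn c), Outer (Dn d)}} \<union>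
      (\<lambda>j. {Outer (Up j), Mid j, Outer (Dn j)}) ` ?J"
  have G: "?G = ({{Outer (Up a), Outer (Up b)}, {Mid a, Mid b}} \<union>
        (\<lambda>j. {Outer (Up j), Mid j}) ` ({1..n} - {a, b})) \<union>
      ({{Mid c, Mid d}, {Outer (Dn c), Outer (Dn d)}} \<union>
        (\<lambda>j. {Mid j, Outer (Dn j)}) ` ({1..n} - {c, d}))"
    unfolding glued_blocks_def cupcap_image image_Un image_insert image_empty image_image
    by (simp only: image_insert image_empty glue_first.simps glue_second.simps)
  have up: "(Outer (Up j), Mid j) \<in> conn ?G" if "j \<in> {1..n} - {a, b}" for j
    by (rule conn_block[of "{Outer (Up j), Mid j}"]) (use that in \<open>auto simp: G\<close>)
  have dn: "(Mid j, Outer (Dn j)) \<in> conn ?G" if "j \<in> {1..n} - {c, d}" for j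
    by (rule conn_block[of "{Mid j, Outer (Dn j)}"]) (use that in \<open>auto simp: G\<close>)
  \<comment> \<open>It suffices to connect all points of a part to one centre.\<close>
  have star: "\<forall>x\<in>p. \<forall>y\<in>p. (x, y) \<in> conn ?G" if "\<forall>x\<in>p. (x, z) \<in> conn ?G" for p z
  proof (intro ballI)
    fix x y assume "x \<in> p" "y \<in> p"
    then have "(x, z) \<in> conn ?G" "(y, z) \<in> conn ?G" using that by simp_all
    then show "(x, y) \<in> conn ?G" by (rule conn_trans[OF _ conn_sym])
  qed
  have comps: "comps ?G = ?P"
  proof (rule comps_eqI)
    show "partition_on (Outer ` vertices n \<union> Mid ` {1..n}) ?P"
    proof (rule partition_onI)
      show "\<Union>?P = Outer ` vertices n \<union> Mid ` {1..n}"
        using assms by (auto simp: vertices_def)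
    qed (use dist in \<open>auto simp: disjnt_def\<close>)
    show "\<Union>?G = Outer ` vertices n \<union> Mid ` {1..n}"
      by (rule Union_glued_blocks) (use assms in \<open>auto intro!: cupcap_closed\<close>)
    show "\<exists>p\<in>?P. l \<subseteq> p" if "l \<in> ?G" for l
      using that unfolding G by auto
    have "(Mid b, Mid a) \<in> conn ?G" by (rule conn_block[of "{Mid a, Mid b}"]) (simp_all add: G)
    moreover have "(Outer (Dn a), Mid a) \<in> conn ?G" "(Outer (Dn b), Mid b) \<in> conn ?G"
      using assms by (auto intro!: conn_sym[OF dn])
    ultimately have m: "\<forall>x\<in>p. \<forall>y\<in>p. (x, y) \<in> conn ?G"
      if "p = {Mid a, Mid b, Outer (Dn a), Outer (Dn b)}" for p
      unfolding that using conn_trans[of "Outer (Dn b)" "Mid b" ?G "Mid a"]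
      by (intro star[of _ "Mid a"]) simp
    have "(Mid d, Mid c) \<in> conn ?G" by (rule conn_block[of "{Mid c, Mid d}"]) (simp_all add: G)
    moreover have "(Outer (Up c), Mid c) \<in> conn ?G" "(Outer (Up d), Mid d) \<in> conn ?G"
      using assms by (auto intro!: up)
    ultimately have m': "\<forall>x\<in>p. \<forall>y\<in>p. (x, y) \<in> conn ?G"
      if "p = {Outer (Up c), Outer (Up d), Mid c, Mid d}" for p
      unfolding that using conn_trans[of "Outer (Up d)" "Mid d" ?G "Mid c"]
      by (intro star[of _ "Mid c"]) simp
    have j: "\<forall>x\<in>p. \<forall>y\<in>p. (x, y) \<in> conn ?G"
      if pJ: "p \<in> (\<lambda>j. {Outer (Up j), Mid j, Outer (Dn j)}) ` ?J" for p
    proof -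
      obtain j where "j \<in> ?J" and p: "p = {Outer (Up j), Mid j, Outer (Dn j)}"
        using pJ by (rule imageE)
      then have "(Outer (Up j), Mid j) \<in> conn ?G" "(Outer (Dn j), Mid j) \<in> conn ?G"
        by (auto intro!: up conn_sym[OF dn])
      then show ?thesis unfolding p by (intro star[of _ "Mid j"]) simp
    qed
    have e: "\<forall>x\<in>p. \<forall>y\<in>p. (x, y) \<in> conn ?G" if "p \<in> ?G" for p
      by (intro ballI conn_block[OF that])
    show "(x, y) \<in> conn ?G" if p: "p \<in> ?P" and "x \<in> p" "y \<in> p" for p x y
    proof -
      have "p \<in> ?G \<or> p = {Mid a, Mid b, Outer (Dn a), Outer (Dn b)} \<or>
          p = {Outer (Up c), Outer (Up d), Mid c, Mid d} \<or>
          p \<in> (\<lambda>j. {Outer (Up j), Mid j, Outer (Dn j)}) ` ?J"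
        using p by (elim UnE insertE emptyE) (simp_all add: G)
      then show ?thesis using e m m' j that(2,3) by meson
    qed
  qed
  show "loops (cupcap n a b) (cupcap n c d) = 0"
    unfolding loops_comps comps by auto
  have "Outer -` {Outer (Up j), Mid j, Outer (Dn j)} = {Up j, Dn j}" for j by auto
  moreover have "Outer -` {Outer (Up a), Outer (Up b)} = {Up a, Up b}"
    "Outer -` {Mid a, Mid b, Outer (Dn a), Outer (Dn b)} = {Dn a, Dn b}"
    "Outer -` {Outer (Up c), Outer (Up d), Mid c, Mid d} = {Up c, Up d}"
    "Outer -` {Outer (Dn c), Outer (Dn d)} = {Dn c, Dn d}" by auto
  ultimately have "(-`) Outer ` ?P = {{Up a, Up b}, {Dn a, Dn b}, {Up c, Up d}, {Dn c, Dn d}} \<union>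
      (\<lambda>j. {Up j, Dn j}) ` ?J"
    unfolding image_Un image_insert image_empty image_image by (simp only:)
  then have "diagram_comp (cupcap n a b) (cupcap n c d) =
      {{Up a, Up b}, {Dn a, Dn b}, {Up c, Up d}, {Dn c, Dn d}} \<union> (\<lambda>j. {Up j, Dn j}) ` ?J - {{}}"
    unfolding diagram_comp_comps comps by (simp only:)
  also have "\<dots> = {{Up a, Up b}, {Dn a, Dn b}, {Up c, Up d}, {Dn c, Dn d}} \<union>
      (\<lambda>j. {Up j, Dn j}) ` ?J"
    by (rule Diff_triv) auto
  finally show "diagram_comp (cupcap n a b) (cupcap n c d) =
      {{Up a, Up b}, {Dn a, Dn b}, {Up c, Up d}, {Dn c, Dn d}} \<union>
      {{Up j, Dn j} |j. j \<in> {1..n} - {a, b, c, d}}"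
    by (simp only: Setcompr_eq_image)
qed

lemma cupcap_comm:
  assumes "a \<in> {1..n}" "b \<in> {1..n}" "c \<in> {1..n}" "d \<in> {1..n}" and dist: "distinct [a, b, c, d]"
  shows "diagram_comp (cupcap n a b) (cupcap n c d) = diagram_comp (cupcap n c d) (cupcap n a b)"
proof -
  have "distinct [c, d, a, b]" using dist by auto
  note * = cupcap_mult[OF assms] cupcap_mult[OF assms(3,4,1,2) this]
  show ?thesis unfolding * by (auto simp: insert_commute)
qed


section \<open>The multiplicative monoid of the Brauer algebra\<close>

text \<open>
  The product with its sum over pairs split into a double sum, so that sums can be
  interchanged.
\<close>

lemma Br_mult:
  "(x \<otimes>\<^bsub>Br n\<^esub> y) d = (\<Sum>d1\<in>brauer_diagrams n. \<Sum>d2\<in>brauer_diagrams n.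
    if diagram_comp d1 d2 = d then x d1 * y d2 * [:0, 1:] ^ loops d1 d2 else 0)"
proof -
  let ?D = "brauer_diagrams n"
  have "(x \<otimes>\<^bsub>Br n\<^esub> y) d = (\<Sum>(d1, d2)\<in>{p \<in> ?D \<times> ?D. diagram_comp (fst p) (snd p) = d}.
      x d1 * y d2 * [:0, 1:] ^ loops d1 d2)"
    unfolding Br_def by (auto intro!: sum.cong)
  also have "\<dots> = (\<Sum>p\<in>?D \<times> ?D. if diagram_comp (fst p) (snd p) = d
      then x (fst p) * y (snd p) * [:0, 1:] ^ loops (fst p) (snd p) else 0)"
    by (subst sum.inter_filter[symmetric]) (simp_all add: finite_brauer_diagrams case_prod_beta)
  also have "\<dots> = (\<Sum>d1\<in>?D. \<Sum>d2\<in>?D.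
      if diagram_comp d1 d2 = d then x d1 * y d2 * [:0, 1:] ^ loops d1 d2 else 0)"
    by (simp add: sum.cartesian_product case_prod_beta)
  finally show ?thesis .
qed

lemma Br_carrier: "x \<in> carrier (Br n) \<longleftrightarrow> (\<forall>d. d \<notin> brauer_diagrams n \<longrightarrow> x d = 0)"
  by (simp add: Br_def)

lemma Br_one: "\<one>\<^bsub>Br n\<^esub> = basis_element (id_diagram n)"
  by (simp add: Br_def)

lemma basis_element_closed: "d \<in> brauer_diagrams n \<Longrightarrow> basis_element d \<in> carrier (Br n)"
  by (auto simp: Br_carrier basis_element_def)

lemma Br_mult_closed: "x \<otimes>\<^bsub>Br n\<^esub> y \<in> carrier (Br n)"
  unfolding Br_carrier Br_mult
  using diagram_comp_closed by (auto intro!: sum.neutral)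

lemma basis_element_mult_left:
  assumes "d1 \<in> brauer_diagrams n"
  shows "(basis_element d1 \<otimes>\<^bsub>Br n\<^esub> y) d = (\<Sum>d2\<in>brauer_diagrams n.
    if diagram_comp d1 d2 = d then y d2 * [:0, 1:] ^ loops d1 d2 else 0)"
proof -
  have "(basis_element d1 \<otimes>\<^bsub>Br n\<^esub> y) d = (\<Sum>d'\<in>brauer_diagrams n. if d' = d1 then
      (\<Sum>d2\<in>brauer_diagrams n. if diagram_comp d1 d2 = d then y d2 * [:0, 1:] ^ loops d1 d2 else 0) else 0)"
    unfolding Br_mult by (rule sum.cong) (simp_all add: basis_element_def cong: if_cong)
  then show ?thesis using assms by (simp add: finite_brauer_diagrams)
qed

lemma basis_element_mult_right:
  assumes "d2 \<in> brauer_diagrams n"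
  shows "(x \<otimes>\<^bsub>Br n\<^esub> basis_element d2) d = (\<Sum>d1\<in>brauer_diagrams n.
    if diagram_comp d1 d2 = d then x d1 * [:0, 1:] ^ loops d1 d2 else 0)"
proof -
  have "(\<Sum>d'\<in>brauer_diagrams n. if diagram_comp d1 d' = d
      then x d1 * basis_element d2 d' * [:0, 1:] ^ loops d1 d' else 0) =
    (if diagram_comp d1 d2 = d then x d1 * [:0, 1:] ^ loops d1 d2 else 0)" for d1
  proof -
    have "(\<Sum>d'\<in>brauer_diagrams n. if diagram_comp d1 d' = d
        then x d1 * basis_element d2 d' * [:0, 1:] ^ loops d1 d' else 0) =
      (\<Sum>d'\<in>brauer_diagrams n. if d' = d2 then
        (if diagram_comp d1 d2 = d then x d1 * [:0, 1:] ^ loops d1 d2 else 0) else 0)"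
      by (rule sum.cong) (auto simp: basis_element_def)
    then show ?thesis using assms by (simp add: finite_brauer_diagrams)
  qed
  then show ?thesis unfolding Br_mult by simp
qed

text \<open>
  Products of diagrams that create no loop stay inside the basis; all products in the defining
  relations are of this kind.
\<close>

lemma basis_element_mult:
  assumes "d1 \<in> brauer_diagrams n" "d2 \<in> brauer_diagrams n" and "loops d1 d2 = 0"
  shows "basis_element d1 \<otimes>\<^bsub>Br n\<^esub> basis_element d2 = basis_element (diagram_comp d1 d2)"
proof
  fix d
  have "(basis_element d1 \<otimes>\<^bsub>Br n\<^esub> basis_element d2) d = (\<Sum>d'\<in>brauer_diagrams n.
      if d' = d2 then (if diagram_comp d1 d2 = d then 1 else 0) else 0)"
    unfolding basis_element_mult_left[OF assms(1)]
    using assms(3) by (intro sum.cong) (auto simp: basis_element_def)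
  then show "(basis_element d1 \<otimes>\<^bsub>Br n\<^esub> basis_element d2) d = basis_element (diagram_comp d1 d2) d"
    using assms(2) by (simp add: finite_brauer_diagrams basis_element_def)
qed

lemma sum_rotate:
  "(\<Sum>c\<in>C. \<Sum>a\<in>A. \<Sum>b\<in>B. f a b c) = (\<Sum>a\<in>A. \<Sum>b\<in>B. \<Sum>c\<in>C. f a b c)"
  by (subst sum.swap) (rule sum.cong[OF HOL.refl sum.swap])

text \<open>
  Both sides expand to the sum over all triples of diagrams, where the summands agree by
  associativity of gluing; the sum over the intermediate composite \<open>p\<close> has a single non-zero term
  because composites of Brauer diagrams are Brauer diagrams.
\<close>

lemma Br_mult_assoc:
  "x \<otimes>\<^bsub>Br n\<^esub> y \<otimes>\<^bsub>Br n\<^esub> z = x \<otimes>\<^bsub>Br n\<^esub> (y \<otimes>\<^bsub>Br n\<^esub> z)"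
proof
  fix d
  let ?D = "brauer_diagrams n"
  let ?\<delta> = "[:0, 1:] :: int poly"
  define l where "l d1 d2 d3 = (if diagram_comp (diagram_comp d1 d2) d3 = d
      then x d1 * y d2 * z d3 * ?\<delta> ^ (loops d1 d2 + loops (diagram_comp d1 d2) d3) else 0)"
    for d1 d2 d3
  define r where "r d1 d2 d3 = (if diagram_comp d1 (diagram_comp d2 d3) = d
      then x d1 * y d2 * z d3 * ?\<delta> ^ (loops d2 d3 + loops d1 (diagram_comp d2 d3)) else 0)"
    for d1 d2 d3
  have l: "(if diagram_comp p d3 = d then (x \<otimes>\<^bsub>Br n\<^esub> y) p * z d3 * ?\<delta> ^ loops p d3 else 0) =
      (\<Sum>d1\<in>?D. \<Sum>d2\<in>?D. if diagram_comp d1 d2 = p then l d1 d2 d3 else 0)" for p d3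
  proof (cases "diagram_comp p d3 = d")
    case True
    then show ?thesis unfolding Br_mult
      by (simp add: sum_distrib_right, intro sum.cong HOL.refl) (simp add: l_def power_add mult_ac)
  next
    case False
    then have "(if diagram_comp d1 d2 = p then l d1 d2 d3 else 0) = 0" for d1 d2
      by (simp add: l_def)
    with False show ?thesis by simp
  qed
  have r: "(if diagram_comp d1 p = d then x d1 * (y \<otimes>\<^bsub>Br n\<^esub> z) p * ?\<delta> ^ loops d1 p else 0) =
      (\<Sum>d2\<in>?D. \<Sum>d3\<in>?D. if diagram_comp d2 d3 = p then r d1 d2 d3 else 0)" for p d1
  proof (cases "diagram_comp d1 p = d")
    case True
    then show ?thesis unfolding Br_mult
      by (simp add: sum_distrib_right sum_distrib_left, intro sum.cong HOL.refl)
        (simp add: r_def power_add mult_ac)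
  next
    case False
    then have "(if diagram_comp d2 d3 = p then r d1 d2 d3 else 0) = 0" for d2 d3
      by (simp add: r_def)
    with False show ?thesis by simp
  qed
  have lr: "l d1 d2 d3 = r d1 d2 d3" if "d1 \<in> ?D" "d2 \<in> ?D" "d3 \<in> ?D" for d1 d2 d3
    unfolding l_def r_def diagram_comp_assoc[OF finite_comps_stack_blocks[OF that]] ..
  have collapse: "(\<Sum>p\<in>?D. if diagram_comp d1 d2 = p then c else 0) = c"
    if "d1 \<in> ?D" "d2 \<in> ?D" for d1 d2 and c :: "int poly"
    using diagram_comp_closed[OF that] by (simp add: finite_brauer_diagrams)
  have "(x \<otimes>\<^bsub>Br n\<^esub> y \<otimes>\<^bsub>Br n\<^esub> z) d = (\<Sum>p\<in>?D. \<Sum>d3\<in>?D. \<Sum>d1\<in>?D. \<Sum>d2\<in>?D.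
      if diagram_comp d1 d2 = p then l d1 d2 d3 else 0)"
    unfolding Br_mult[of n "x \<otimes>\<^bsub>Br n\<^esub> y"] l ..
  also have "\<dots> = (\<Sum>d3\<in>?D. \<Sum>d1\<in>?D. \<Sum>d2\<in>?D. \<Sum>p\<in>?D.
      if diagram_comp d1 d2 = p then l d1 d2 d3 else 0)"
    by (subst sum.swap) (rule sum.cong[OF HOL.refl sum_rotate])
  also have "\<dots> = (\<Sum>d3\<in>?D. \<Sum>d1\<in>?D. \<Sum>d2\<in>?D. r d1 d2 d3)"
    by (intro sum.cong HOL.refl) (simp add: collapse lr)
  also have "\<dots> = (\<Sum>d1\<in>?D. \<Sum>d2\<in>?D. \<Sum>d3\<in>?D. r d1 d2 d3)"
    by (rule sum_rotate)
  also have "\<dots> = (\<Sum>d1\<in>?D. \<Sum>d2\<in>?D. \<Sum>d3\<in>?D. \<Sum>p\<in>?D.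
      if diagram_comp d2 d3 = p then r d1 d2 d3 else 0)"
    by (intro sum.cong HOL.refl) (simp add: collapse)
  also have "\<dots> = (\<Sum>d1\<in>?D. \<Sum>p\<in>?D. \<Sum>d2\<in>?D. \<Sum>d3\<in>?D.
      if diagram_comp d2 d3 = p then r d1 d2 d3 else 0)"
    by (rule sum.cong[OF HOL.refl sum_rotate[symmetric]])
  also have "\<dots> = (x \<otimes>\<^bsub>Br n\<^esub> (y \<otimes>\<^bsub>Br n\<^esub> z)) d"
    unfolding Br_mult[of n x] r ..
  finally show "(x \<otimes>\<^bsub>Br n\<^esub> y \<otimes>\<^bsub>Br n\<^esub> z) d = (x \<otimes>\<^bsub>Br n\<^esub> (y \<otimes>\<^bsub>Br n\<^esub> z)) d" .
qed

lemma monoid_Br: "monoid (Br n)"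
proof (rule monoidI)
  show "\<one>\<^bsub>Br n\<^esub> \<in> carrier (Br n)"
    unfolding Br_one by (rule basis_element_closed[OF id_diagram_closed])
  fix x assume x: "x \<in> carrier (Br n)"
  show "\<one>\<^bsub>Br n\<^esub> \<otimes>\<^bsub>Br n\<^esub> x = x"
  proof
    fix d
    have "(\<one>\<^bsub>Br n\<^esub> \<otimes>\<^bsub>Br n\<^esub> x) d = (\<Sum>d2\<in>brauer_diagrams n. if d2 = d then x d else 0)"
      unfolding Br_one basis_element_mult_left[OF id_diagram_closed]
      by (rule sum.cong) (auto simp: id_diagram_comp loops_id_left)
    then show "(\<one>\<^bsub>Br n\<^esub> \<otimes>\<^bsub>Br n\<^esub> x) d = x d"
      using x by (simp add: finite_brauer_diagrams Br_carrier)
  qed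
  show "x \<otimes>\<^bsub>Br n\<^esub> \<one>\<^bsub>Br n\<^esub> = x"
  proof
    fix d
    have "(x \<otimes>\<^bsub>Br n\<^esub> \<one>\<^bsub>Br n\<^esub>) d = (\<Sum>d1\<in>brauer_diagrams n. if d1 = d then x d else 0)"
      unfolding Br_one basis_element_mult_right[OF id_diagram_closed]
      by (rule sum.cong) (auto simp: comp_id_diagram loops_id_right)
    then show "(x \<otimes>\<^bsub>Br n\<^esub> \<one>\<^bsub>Br n\<^esub>) d = x d"
      using x by (simp add: finite_brauer_diagrams Br_carrier)
  qed
qed (rule Br_mult_closed Br_mult_assoc)+

section \<open>The universal property of a presented monoid\<close>

definition word_value :: "('b, 'm) monoid_scheme \<Rightarrow> ('a \<Rightarrow> 'b) \<Rightarrow> 'a list \<Rightarrow> 'b" where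
  "word_value M f w = foldr (\<lambda>a x. f a \<otimes>\<^bsub>M\<^esub> x) w \<one>\<^bsub>M\<^esub>"

lemma word_value_simps [simp]:
  "word_value M f [] = \<one>\<^bsub>M\<^esub>" "word_value M f (a # w) = f a \<otimes>\<^bsub>M\<^esub> word_value M f w"
  by (simp_all add: word_value_def)

context monoid
begin

lemma word_value_closed:
  "f \<in> A \<rightarrow> carrier G \<Longrightarrow> w \<in> lists A \<Longrightarrow> word_value G f w \<in> carrier G"
  by (induction w) auto

lemma word_value_append:
  "f \<in> A \<rightarrow> carrier G \<Longrightarrow> u \<in> lists A \<Longrightarrow> v \<in> lists A \<Longrightarrow>
    word_value G f (u @ v) = word_value G f u \<otimes> word_value G f v"
  by (induction u) (auto simp: m_assoc word_value_closed Pi_iff)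

lemma word_value_cong:
  assumes f: "f \<in> A \<rightarrow> carrier G" and R: "R \<subseteq> lists A \<times> lists A"
    and rel: "\<And>u v. (u, v) \<in> R \<Longrightarrow> word_value G f u = word_value G f v"
    and uv: "(u, v) \<in> word_cong A R"
  shows "word_value G f u = word_value G f v"
  using uv
proof induction
  case (rel u v a b)
  then have "u \<in> lists A" "v \<in> lists A" using R by auto
  then show ?case using rel assms(3)[OF rel(1)] by (simp add: word_value_append[OF f])
qed simp_all

end

lemma word_cong_lists:
  assumes "R \<subseteq> lists A \<times> lists A"
  shows "(u, v) \<in> word_cong A R \<Longrightarrow> u \<in> lists A \<and> v \<in> lists A"
  by (induction rule: word_cong.induct) (use assms in auto)

lemma equiv_word_cong:
  assumes "R \<subseteq> lists A \<times> lists A"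
  shows "equiv (lists A) (word_cong A R)"
proof (rule equivI)
  show "word_cong A R \<subseteq> lists A \<times> lists A" using word_cong_lists[OF assms] by auto
  show "refl_on (lists A) (word_cong A R)" by (auto intro!: refl_onI word_cong.refl)
  show "sym (word_cong A R)" by (rule symI) (rule word_cong.sym)
  show "trans (word_cong A R)" by (rule transI) (rule word_cong.trans)
qed

lemma word_cong_context:
  assumes R: "R \<subseteq> lists A \<times> lists A" and uv: "(u, v) \<in> word_cong A R"
    and c: "c \<in> lists A" and e: "e \<in> lists A"
  shows "(c @ u @ e, c @ v @ e) \<in> word_cong A R"
  using uv
proof induction
  case (refl w)
  then show ?case using c e by (intro word_cong.refl) simp
next
  case (rel u v a b)
  then show ?case using word_cong.rel[of u v R "c @ a" A "b @ e"] c e by simp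
qed (blast intro: word_cong.sym word_cong.trans)+

abbreviation word_class :: "'a set \<Rightarrow> ('a list \<times> 'a list) set \<Rightarrow> 'a list \<Rightarrow> 'a list set" where
  "word_class A R w \<equiv> word_cong A R `` {w}"

lemma presented_mult:
  assumes R: "R \<subseteq> lists A \<times> lists A" and u: "u \<in> lists A" and v: "v \<in> lists A"
  shows "word_class A R u \<otimes>\<^bsub>presented_monoid A R\<^esub> word_class A R v = word_class A R (u @ v)"
proof -
  have "word_class A R (x @ y) = word_class A R (u @ v)"
    if x: "x \<in> word_class A R u" and y: "y \<in> word_class A R v" for x y
  proof -
    have xy: "(u, x) \<in> word_cong A R" "(v, y) \<in> word_cong A R" using x y by auto
    then have "x \<in> lists A" using word_cong_lists[OF R] by auto
    then have "(u @ v, x @ v) \<in> word_cong A R" "(x @ v, x @ y) \<in> word_cong A R"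
      using word_cong_context[OF R xy(1), of "[]" v] word_cong_context[OF R xy(2), of x "[]"] v
      by simp_all
    then have "(u @ v, x @ y) \<in> word_cong A R" by (rule word_cong.trans)
    then show ?thesis using equiv_class_eq[OF equiv_word_cong[OF R]] by simp
  qed
  then have "word_class A R u \<otimes>\<^bsub>presented_monoid A R\<^esub> word_class A R v =
      (\<Union>x\<in>word_class A R u. \<Union>y\<in>word_class A R v. word_class A R (u @ v))"
    unfolding presented_monoid_def monoid.simps by (intro SUP_cong HOL.refl)
  moreover have "word_class A R u \<noteq> {}" "word_class A R v \<noteq> {}"
    using word_cong.refl[OF u] word_cong.refl[OF v] by blast+
  ultimately show ?thesis by (simp only: UN_constant if_False)
qed

lemma presented_carrier:
  "carrier (presented_monoid A R) = word_class A R ` lists A"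
  by (auto simp: presented_monoid_def quotient_def)

lemma presented_one: "\<one>\<^bsub>presented_monoid A R\<^esub> = word_class A R []"
  by (simp add: presented_monoid_def)

text \<open>
  The value of a word depends only on its class, because words with equal values form a
  congruence containing the relations.
\<close>

lemma presented_monoid_lift:
  assumes M: "monoid M" and R: "R \<subseteq> lists A \<times> lists A" and f: "f \<in> A \<rightarrow> carrier M"
    and rel: "\<And>u v. (u, v) \<in> R \<Longrightarrow> word_value M f u = word_value M f v"
  obtains h where "h \<in> hom (presented_monoid A R) M" "h \<one>\<^bsub>presented_monoid A R\<^esub> = \<one>\<^bsub>M\<^esub>"
    "h \<in> extensional (carrier (presented_monoid A R))"
    "\<And>a. a \<in> A \<Longrightarrow> h (word_class A R [a]) = f a"
proof -
  interpret monoid M by (rule M)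
  \<comment> \<open>Outside the carrier the default value of \<^const>\<open>restrict\<close> makes \<open>h\<close> extensional.\<close>
  define h where "h = restrict (\<lambda>X. word_value M f (SOME w. w \<in> X)) (carrier (presented_monoid A R))"
  have h: "h (word_class A R w) = word_value M f w" if w: "w \<in> lists A" for w
  proof -
    have "w \<in> word_class A R w" using w by (auto intro: word_cong.refl)
    then have "(SOME w'. w' \<in> word_class A R w) \<in> word_class A R w" by (rule someI)
    then have "word_value M f w = word_value M f (SOME w'. w' \<in> word_class A R w)"
      by (intro word_value_cong[OF f R rel]) simp_all
    then show ?thesis using w by (simp add: h_def presented_carrier)
  qed
  show ?thesis
  proof
    show "h \<in> hom (presented_monoid A R) M"
    proof (rule homI)
      fix X assume "X \<in> carrier (presented_monoid A R)"
      then obtain u where u: "u \<in> lists A" "X = word_class A R u" by (auto simp: presented_carrier)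
      then show "h X \<in> carrier M" using word_value_closed[OF f] h by simp
      fix Y assume "Y \<in> carrier (presented_monoid A R)"
      then obtain v where v: "v \<in> lists A" "Y = word_class A R v" by (auto simp: presented_carrier)
      have "u @ v \<in> lists A" using u v by simp
      then show "h (X \<otimes>\<^bsub>presented_monoid A R\<^esub> Y) = h X \<otimes>\<^bsub>M\<^esub> h Y"
        using u v by (simp only: presented_mult[OF R u(1) v(1)] h word_value_append[OF f])
    qed
    show "h \<one>\<^bsub>presented_monoid A R\<^esub> = \<one>\<^bsub>M\<^esub>" using h[of "[]"] by (simp add: presented_one)
    show "h \<in> extensional (carrier (presented_monoid A R))" unfolding h_def by simp
    show "h (word_class A R [a]) = f a" if "a \<in> A" for a
      using h[of "[a]"] that f by (simp add: Pi_iff)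
  qed
qed

lemma presented_monoid_hom_eqI:
  assumes R: "R \<subseteq> lists A \<times> lists A"
    and g: "g \<in> hom (presented_monoid A R) M" "g \<one>\<^bsub>presented_monoid A R\<^esub> = \<one>\<^bsub>M\<^esub>"
      "g \<in> extensional (carrier (presented_monoid A R))"
    and h: "h \<in> hom (presented_monoid A R) M" "h \<one>\<^bsub>presented_monoid A R\<^esub> = \<one>\<^bsub>M\<^esub>"
      "h \<in> extensional (carrier (presented_monoid A R))"
    and eq: "\<And>a. a \<in> A \<Longrightarrow> g (word_class A R [a]) = h (word_class A R [a])"
  shows "g = h"
proof (rule extensionalityI[OF g(3) h(3)])
  have "g (word_class A R w) = h (word_class A R w)" if "w \<in> lists A" for w
    using that
  proof (induction w)
    case Nil
    then show ?case using g(2) h(2) by (simp add: presented_one)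
  next
    case (Cons a w)
    then have aw: "a \<in> A" "[a] \<in> lists A" "w \<in> lists A" by auto
    then have "word_class A R [a] \<in> carrier (presented_monoid A R)"
      "word_class A R w \<in> carrier (presented_monoid A R)" unfolding presented_carrier by blast+
    moreover have "word_class A R (a # w) =
        word_class A R [a] \<otimes>\<^bsub>presented_monoid A R\<^esub> word_class A R w"
      using presented_mult[OF R aw(2,3)] by simp
    ultimately show ?case using hom_mult[OF g(1)] hom_mult[OF h(1)] eq[OF aw(1)] Cons by simp
  qed
  then show "g X = h X" if "X \<in> carrier (presented_monoid A R)" for X
    using that unfolding presented_carrier by auto
qed

section \<open>The homomorphism from the singular braid monoid\<close>

lemma s_diagram_perm:
  assumes "i \<in> {1..<n}"
  shows "s_diagram n i = perm_diagram n (transpose i (i + 1))"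
proof -
  have "{1..n} = {i, i + 1} \<union> ({1..n} - {i, i + 1})"
    by (rule Set.set_eqI) (use assms in auto)
  then have "perm_diagram n (transpose i (i + 1)) =
      (\<lambda>j. {Up (transpose i (i + 1) j), Dn j}) ` ({i, i + 1} \<union> ({1..n} - {i, i + 1}))"
    unfolding perm_diagram_image by (rule arg_cong)
  also have "\<dots> = {{Up i, Dn (i + 1)}, {Up (i + 1), Dn i}} \<union>
      (\<lambda>j. {Up (transpose i (i + 1) j), Dn j}) ` ({1..n} - {i, i + 1})"
    unfolding image_Un image_insert image_empty transpose_apply_first transpose_apply_second
    by (simp only: insert_commute)
  also have "(\<lambda>j. {Up (transpose i (i + 1) j), Dn j}) ` ({1..n} - {i, i + 1}) =
      (\<lambda>j. {Up j, Dn j}) ` ({1..n} - {i, i + 1})"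
    by (rule image_cong) (simp_all add: transpose_def)
  finally show ?thesis by (simp only: s_diagram_def Setcompr_eq_image)
qed

lemma e_diagram_cupcap: "e_diagram n i = cupcap n i (i + 1)"
  by (simp add: e_diagram_def cupcap_def)

lemma transpose_permutes: "i \<in> {1..<n} \<Longrightarrow> transpose i (i + 1) permutes {1..n}"
  for i n :: nat
  by (rule permutes_swap_id) auto

lemma perm_element_mult:
  assumes "p permutes {1..n}" "q permutes {1..n}"
  shows "basis_element (perm_diagram n p) \<otimes>\<^bsub>Br n\<^esub> basis_element (perm_diagram n q) =
    basis_element (perm_diagram n (p \<circ> q))"
  using assms
  by (simp add: basis_element_mult perm_diagram_closed loops_perm_left perm_diagram_mult)

lemma perm_cupcap_element:
  assumes p: "p permutes {1..n}" and ab: "a \<in> {1..n}" "b \<in> {1..n}" "a \<noteq> b"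
  shows "basis_element (perm_diagram n p) \<otimes>\<^bsub>Br n\<^esub> basis_element (cupcap n a b) =
    basis_element (cupcap n (p a) (p b)) \<otimes>\<^bsub>Br n\<^esub> basis_element (perm_diagram n p)"
proof -
  have "p a \<in> {1..n}" "p b \<in> {1..n}" "p a \<noteq> p b"
    using ab permutes_in_image[OF p] injD[OF permutes_inj[OF p]] by blast+
  then show ?thesis
    using p ab by (simp add: basis_element_mult perm_diagram_closed cupcap_closed
        loops_perm_left loops_perm_right perm_cupcap)
qed

text \<open>
  A transposition is its own inverse, so \<open>\<sigma>\<^sub>i\<inverse>\<close> goes to \<open>s\<^sub>i\<close> as well.
\<close>

fun gen_image :: "nat \<Rightarrow> sb_gen \<Rightarrow> diagram \<Rightarrow> int poly" where
  "gen_image n (Sigma i) = basis_element (s_diagram n i)"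
| "gen_image n (Sigma_inv i) = basis_element (s_diagram n i)"
| "gen_image n (Tau i) = basis_element (e_diagram n i)"

lemma s_diagram_closed: "i \<in> {1..<n} \<Longrightarrow> s_diagram n i \<in> brauer_diagrams n"
  by (simp only: s_diagram_perm perm_diagram_closed transpose_permutes)

lemma e_diagram_closed: "i \<in> {1..<n} \<Longrightarrow> e_diagram n i \<in> brauer_diagrams n"
  unfolding e_diagram_cupcap by (rule cupcap_closed) auto

lemma gen_image_closed: "gen_image n \<in> sb_gens n \<rightarrow> carrier (Br n)"
  by (auto simp: sb_gens_def basis_element_closed s_diagram_closed e_diagram_closed)

lemma sb_rels_lists: "sb_rels n \<subseteq> lists (sb_gens n) \<times> lists (sb_gens n)"
proof -
  have "u \<in> lists (sb_gens n) \<and> v \<in> lists (sb_gens n)" if "(u, v) \<in> sb_rels n" for u v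
    using that by cases (auto simp: sb_gens_def)
  then show ?thesis by auto
qed

text \<open>
  With \<open>S p\<close> the element of a permutation and \<open>E a b\<close> that of a cup-cap diagram, the relations follow
  from \<open>S p \<cdot> S q = S (p \<circ> q)\<close>, \<open>S p \<cdot> E a b = E (p a) (p b) \<cdot> S p\<close> and \<open>E a b = E b a\<close>.
\<close>

lemma gen_image_respects:
  assumes "(u, v) \<in> sb_rels n"
  shows "word_value (Br n) (gen_image n) u = word_value (Br n) (gen_image n) v"
proof -
  interpret Br: monoid "Br n" by (rule monoid_Br)
  define S where "S p = basis_element (perm_diagram n p)" for p
  define s where "s i = transpose i (i + 1)" for i :: nat
  define E where "E a b = basis_element (cupcap n a b)" for a b
  have sigma: "gen_image n (Sigma i) = S (s i)" "gen_image n (Sigma_inv i) = S (s i)"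
    if "i \<in> {1..<n}" for i
    using that by (simp_all add: S_def s_def s_diagram_perm)
  have tau: "gen_image n (Tau i) = E i (i + 1)" for i
    by (simp add: E_def e_diagram_cupcap)
  have s: "s i permutes {1..n}" if "i \<in> {1..<n}" for i
    unfolding s_def by (rule transpose_permutes[OF that])
  have S_closed: "S (s i) \<in> carrier (Br n)" if "i \<in> {1..<n}" for i
    unfolding S_def by (intro basis_element_closed perm_diagram_closed s that)
  have E_closed: "E i (i + 1) \<in> carrier (Br n)" if "i \<in> {1..<n}" for i
    unfolding E_def by (intro basis_element_closed cupcap_closed) (use that in auto)
  have S_mult: "S p \<otimes>\<^bsub>Br n\<^esub> S q = S (p \<circ> q)" if "p permutes {1..n}" "q permutes {1..n}" for p q
    unfolding S_def by (rule perm_element_mult[OF that])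
  have S_E: "S p \<otimes>\<^bsub>Br n\<^esub> E i (i + 1) = E (p i) (p (i + 1)) \<otimes>\<^bsub>Br n\<^esub> S p"
    if "p permutes {1..n}" "i \<in> {1..<n}" for p i
    unfolding S_def E_def by (rule perm_cupcap_element[OF that(1)]) (use that(2) in auto)
  have E_commute: "E a b = E b a" for a b
    by (simp add: E_def cupcap_commute)
  have square: "S (s i) \<otimes>\<^bsub>Br n\<^esub> S (s i) = \<one>\<^bsub>Br n\<^esub>" if "i \<in> {1..<n}" for i
    using s[OF that] by (simp add: S_mult) (simp add: S_def s_def Br_one id_diagram_perm)
  from assms show ?thesis
  proof cases
    case (inv_right i)
    then show ?thesis using square[of i] S_closed[of i] by (simp del: gen_image.simps add: sigma)
  next
    case (inv_left i)
    then show ?thesis using square[of i] S_closed[of i] by (simp del: gen_image.simps add: sigma)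
  next
    case (braid i j)
    then have "s i \<circ> s j \<circ> s i = s j \<circ> s i \<circ> s j"
      by (intro ext) (auto simp: s_def transpose_def)
    then show ?thesis using braid s[of i] s[of j] S_closed
      by (simp del: gen_image.simps add: sigma S_mult permutes_compose o_assoc)
  next
    case (mixed_braid i j)
    \<comment> \<open>The product of two neighbouring transpositions moves the pair \<open>j\<close>, \<open>j + 1\<close> to \<open>i\<close>, \<open>i + 1\<close>.\<close>
    have "s j \<circ> s i permutes {1..n}" using mixed_braid by (intro permutes_compose s)
    moreover have "(s j \<circ> s i) j = i" "(s j \<circ> s i) (j + 1) = i + 1"
      using mixed_braid by (auto simp: s_def transpose_def)
    ultimately have "S (s j \<circ> s i) \<otimes>\<^bsub>Br n\<^esub> E j (j + 1) = E i (i + 1) \<otimes>\<^bsub>Br n\<^esub> S (s j \<circ> s i)"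
      using S_E[of "s j \<circ> s i" j] mixed_braid by simp
    then show ?thesis using mixed_braid S_closed E_closed S_mult[OF s[of j] s[of i]]
      by (simp del: gen_image.simps add: sigma tau Br.m_assoc flip: Br.m_assoc[of "S (s j)" "S (s i)"])
  next
    case (far_sigma_sigma i j)
    then have "s i \<circ> s j = s j \<circ> s i"
      by (intro ext) (auto simp: s_def transpose_def)
    then show ?thesis using far_sigma_sigma S_closed S_mult[OF s[of i] s[of j]]
        S_mult[OF s[of j] s[of i]] by (simp del: gen_image.simps add: sigma)
  next
    case (far_tau_sigma i j)
    then have "s j i = i" "s j (i + 1) = i + 1" by (auto simp: s_def transpose_def)
    then show ?thesis using far_tau_sigma S_closed E_closed S_E[OF s[of j], of i]
      by (simp del: gen_image.simps add: sigma tau)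
  next
    case (far_tau_tau i j)
    then have ij: "i \<in> {1..n}" "i + 1 \<in> {1..n}" "j \<in> {1..n}" "j + 1 \<in> {1..n}"
      and d: "distinct [i, i + 1, j, j + 1]" by auto
    have d': "distinct [j, j + 1, i, i + 1]" using d by auto
    have "E i (i + 1) \<otimes>\<^bsub>Br n\<^esub> E j (j + 1) = E j (j + 1) \<otimes>\<^bsub>Br n\<^esub> E i (i + 1)"
      using basis_element_mult[OF cupcap_closed[OF ij(1,2)] cupcap_closed[OF ij(3,4)] loops_cupcap[OF ij d]]
        basis_element_mult[OF cupcap_closed[OF ij(3,4)] cupcap_closed[OF ij(1,2)]
          loops_cupcap[OF ij(3,4,1,2) d']]
      by (simp only: E_def cupcap_comm[OF ij d])
    then show ?thesis using far_tau_tau E_closed by (simp del: gen_image.simps add: tau)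
  next
    case (tau_sigma i)
    have "s i i = i + 1" "s i (i + 1) = i" by (simp_all add: s_def)
    then show ?thesis
      using tau_sigma S_closed E_closed S_E[OF s[of i], of i] E_commute[of "i + 1" i]
      by (simp del: gen_image.simps add: sigma tau)
  qed
qed

theorem proposition22:
  fixes n :: nat
  shows "\<exists>!\<chi>. \<chi> \<in> hom (SB n) (Br n) \<and> \<chi> \<one>\<^bsub>SB n\<^esub> = \<one>\<^bsub>Br n\<^esub> \<and>
    \<chi> \<in> extensional (carrier (SB n)) \<and>
    (\<forall>i\<in>{1..<n}. \<chi> (sb_sigma n i) = basis_element (s_diagram n i) \<and>
      \<chi> (sb_tau n i) = basis_element (e_diagram n i))"
proof (rule ex_ex1I)
  interpret Br: monoid "Br n" by (rule monoid_Br)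
  let ?class = "word_class (sb_gens n) (sb_rels n)"
  have gens: "Sigma i \<in> sb_gens n" "Sigma_inv i \<in> sb_gens n" "Tau i \<in> sb_gens n"
    if "i \<in> {1..<n}" for i
    using that by (auto simp: sb_gens_def)
  obtain h where "h \<in> hom (SB n) (Br n)" "h \<one>\<^bsub>SB n\<^esub> = \<one>\<^bsub>Br n\<^esub>"
    "h \<in> extensional (carrier (SB n))"
    and h: "\<And>a. a \<in> sb_gens n \<Longrightarrow> h (?class [a]) = gen_image n a"
    using presented_monoid_lift[OF monoid_Br sb_rels_lists gen_image_closed gen_image_respects]
    unfolding SB_def by metis
  then show "\<exists>\<chi>. \<chi> \<in> hom (SB n) (Br n) \<and> \<chi> \<one>\<^bsub>SB n\<^esub> = \<one>\<^bsub>Br n\<^esub> \<and>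
    \<chi> \<in> extensional (carrier (SB n)) \<and>
    (\<forall>i\<in>{1..<n}. \<chi> (sb_sigma n i) = basis_element (s_diagram n i) \<and>
      \<chi> (sb_tau n i) = basis_element (e_diagram n i))"
    by (intro exI[of _ h]) (simp add: sb_sigma_def sb_tau_def gens)
  fix g h
  assume g: "g \<in> hom (SB n) (Br n) \<and> g \<one>\<^bsub>SB n\<^esub> = \<one>\<^bsub>Br n\<^esub> \<and>
    g \<in> extensional (carrier (SB n)) \<and>
    (\<forall>i\<in>{1..<n}. g (sb_sigma n i) = basis_element (s_diagram n i) \<and>
      g (sb_tau n i) = basis_element (e_diagram n i))"
    and h: "h \<in> hom (SB n) (Br n) \<and> h \<one>\<^bsub>SB n\<^esub> = \<one>\<^bsub>Br n\<^esub> \<and>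
    h \<in> extensional (carrier (SB n)) \<and>
    (\<forall>i\<in>{1..<n}. h (sb_sigma n i) = basis_element (s_diagram n i) \<and>
      h (sb_tau n i) = basis_element (e_diagram n i))"
  have carrier: "?class [a] \<in> carrier (SB n)" if "a \<in> sb_gens n" for a
    unfolding SB_def presented_carrier using that by (intro imageI) simp
  have inverse: "?class [Sigma_inv i] \<otimes>\<^bsub>SB n\<^esub> ?class [Sigma i] = \<one>\<^bsub>SB n\<^esub>"
    "?class [Sigma i] \<otimes>\<^bsub>SB n\<^esub> ?class [Sigma_inv i] = \<one>\<^bsub>SB n\<^esub>" if i: "i \<in> {1..<n}" for i
  proof -
    have *: "([Sigma_inv i, Sigma i], []) \<in> word_cong (sb_gens n) (sb_rels n)"
      "([Sigma i, Sigma_inv i], []) \<in> word_cong (sb_gens n) (sb_rels n)"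
      using word_cong.rel[OF sb_rels.inv_left[OF i], of "[]" "sb_gens n" "[]"]
        word_cong.rel[OF sb_rels.inv_right[OF i], of "[]" "sb_gens n" "[]"] by simp_all
    note eq = *[THEN equiv_class_eq[OF equiv_word_cong[OF sb_rels_lists]]]
    show "?class [Sigma_inv i] \<otimes>\<^bsub>SB n\<^esub> ?class [Sigma i] = \<one>\<^bsub>SB n\<^esub>"
      "?class [Sigma i] \<otimes>\<^bsub>SB n\<^esub> ?class [Sigma_inv i] = \<one>\<^bsub>SB n\<^esub>"
      unfolding SB_def using gens[OF i] eq
      by (simp_all add: presented_mult[OF sb_rels_lists] presented_one)
  qed
  \<comment> \<open>Left inverse under \<open>g\<close> and right inverse under \<open>h\<close> of the same element \<open>s\<^sub>i\<close>.\<close>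
  have inv_eq: "g (?class [Sigma_inv i]) = h (?class [Sigma_inv i])" if i: "i \<in> {1..<n}" for i
  proof -
    have sigma: "g (?class [Sigma i]) = h (?class [Sigma i])"
      using g h i by (simp flip: sb_sigma_def)
    have "g (?class [Sigma_inv i]) \<otimes>\<^bsub>Br n\<^esub> g (?class [Sigma i]) = \<one>\<^bsub>Br n\<^esub>"
      using g hom_mult[of g "SB n" "Br n" "?class [Sigma_inv i]" "?class [Sigma i]"]
        carrier gens[OF i] inverse[OF i] by simp
    moreover have "h (?class [Sigma i]) \<otimes>\<^bsub>Br n\<^esub> h (?class [Sigma_inv i]) = \<one>\<^bsub>Br n\<^esub>"
      using h hom_mult[of h "SB n" "Br n" "?class [Sigma i]" "?class [Sigma_inv i]"]
        carrier gens[OF i] inverse[OF i] by simp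
    ultimately show ?thesis
      using Br.inv_unique[of "g (?class [Sigma_inv i])" "g (?class [Sigma i])"
          "h (?class [Sigma_inv i])"] sigma g h carrier gens[OF i] hom_in_carrier by metis
  qed
  have "g (?class [a]) = h (?class [a])" if a: "a \<in> sb_gens n" for a
  proof -
    consider i where "i \<in> {1..<n}" "a = Sigma i" | i where "i \<in> {1..<n}" "a = Sigma_inv i"
      | i where "i \<in> {1..<n}" "a = Tau i"
      using a unfolding sb_gens_def by blast
    then show ?thesis
    proof cases
      case 2
      then show ?thesis using inv_eq by simp
    qed (use g h in \<open>simp_all flip: sb_sigma_def sb_tau_def\<close>)
  qed
  then show "g = h"
    using g h unfolding SB_def by (intro presented_monoid_hom_eqI[OF sb_rels_lists]) auto
qed

end
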